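(* For every $\varepsilon>0$ there exists $L>0$ such that the following holds. Let $n\ge 1$, let $A\subset \mathbb{F}_2^n$ be a finite nonempty set, and let $\eta$ be defined by $|A+A|=|A|^{2-\eta}$. Then there exists a subspace $V\subset \mathbb{F}_2^n$ such that $|V|\le |A|^{L}$ and \[ \mathbb{E}_{a\in A}\log |A\cap (V+a)| \ \ge\ (\eta-\varepsilon)\log|A|. \]
   Context: $A+A=\{a+a' : a,a'\in A\}$. $\mathbb{E}_{a\in A}$ denotes the average over $a$ chosen uniformly from $A$. The constant $L$ depends only on $\varepsilon$ (not on $n$, $A$ or $\eta$). *)

theory Defs
  imports Complex_Main "HOL-Library.Z2" "HOL-Library.Function_Algebras" "HOL-Library.Set_Algebras"
begin

text \<open>
  The vectors of \<open>F_2^n\<close> are the functions \<open>x :: nat \<Rightarrow> bit\<close> that vanish outside \<open>{..<n}\<close>, so that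
  \<open>n\<close> is a term and a bound can be uniform in it. Vector addition is the pointwise addition of
  functions, and \<open>A + B\<close> on sets is the sumset.
\<close>

definition F2_space :: "nat \<Rightarrow> (nat \<Rightarrow> bit) set"
  where "F2_space n = {x. \<forall>i\<ge>n. x i = 0}"

definition F2_scale :: "bit \<Rightarrow> (nat \<Rightarrow> bit) \<Rightarrow> (nat \<Rightarrow> bit)"
  where "F2_scale c x = (\<lambda>i. c * x i)"

global_interpretation F2: vector_space F2_scale
  by unfold_locales (auto simp: F2_scale_def fun_eq_iff algebra_simps)

lemma subspace_F2_space: "F2.subspace (F2_space n)"
  by (auto simp: F2.subspace_def F2_space_def F2_scale_def)

definition avg :: "'a set \<Rightarrow> ('a \<Rightarrow> real) \<Rightarrow> real"
  where "avg A f = (\<Sum>a\<in>A. f a) / real (card A)"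

end

theory Submission
  imports Defs "HOL-Probability.Probability_Mass_Function"
begin

text \<open>
  Let \<open>X\<close> be uniform on \<open>A\<close> and \<open>M = ln |A|\<close>. The quantity to be bounded below is \<open>M - H(\<pi> X)\<close>, where
  \<open>\<pi>\<close> is a linear map with kernel \<open>V\<close>. By data processing
  \<open>H(\<pi> X + \<pi> X') - H(\<pi> X) \<le> H(X + X') - H(X) \<le> (1 - \<eta>) M\<close>, so it is enough to find a small kernel
  for which \<open>H(\<pi> X + \<pi> X') > 2 H(\<pi> X) - \<epsilon> M\<close>. As long as this fails, the kernel is enlarged by a
  subspace of size \<open>exp (O(M))\<close> such that one of the entropies of the iterated self-convolutions
  \<open>X, X + X', \<dots>\<close> of bounded length drops by a fixed multiple of \<open>M\<close>; this happens boundedly often.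

  The subspace comes from an entropic argument in the style of Gowers, Green, Manners and Tao, for
  variables \<open>Y\<close> carrying a label \<open>Z\<close> on which everything is conditioned. Passing to the sum
  \<open>Y + Y'\<close> or to the fibre \<open>Y | Y + Y'\<close> of independent copies lowers the ratio of the doubling
  \<open>H(Y + Y' | Z, Z') - H(Y | Z)\<close> to \<open>H(Y | Z)\<close> until the fibring identity is almost tight; then the
  entropic Balog-Szemeredi-Gowers theorem, applied to \<open>Y1 + Y2, Y2 + Y3, Y1 + Y3\<close> given
  \<open>Y1 + Y2 + Y3 + Y4\<close>, yields a variable \<open>Y\<close> with doubling much smaller than \<open>H(R | R + Y)\<close>, where
  \<open>R\<close> is a self-convolution of \<open>X\<close>. A near-maximiser of
  \<open>H(R | R + Y) - 20 (H(Y + Y') - H(Y)) - \<lambda> H(Y)\<close> has doubling close to \<open>0\<close> by the same two steps, and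
  such a variable is concentrated on a coset of a subspace.
\<close>

section \<open>Shannon entropy of finitely supported distributions\<close>

definition ent :: "'a pmf \<Rightarrow> real"
  where "ent p = (\<Sum>x\<in>set_pmf p. - pmf p x * ln (pmf p x))"

definition H :: "'a pmf \<Rightarrow> ('a \<Rightarrow> 'b) \<Rightarrow> real"
  where "H p f = ent (map_pmf f p)"

lemma sum_pmf_map:
  assumes "finite (set_pmf p)"
  shows "(\<Sum>y\<in>set_pmf (map_pmf f p). pmf (map_pmf f p) y * g y) = (\<Sum>x\<in>set_pmf p. pmf p x * g (f x))"
proof -
  have "pmf (map_pmf f p) y = (\<Sum>x\<in>{x\<in>set_pmf p. f x = y}. pmf p x)" for y
  proof -
    have "pmf (map_pmf f p) y = measure p (f -` {y} \<inter> set_pmf p)"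
      by (simp add: pmf_map measure_Int_set_pmf)
    also have "\<dots> = sum (pmf p) (f -` {y} \<inter> set_pmf p)"
      using assms by (intro measure_measure_pmf_finite) auto
    also have "f -` {y} \<inter> set_pmf p = {x\<in>set_pmf p. f x = y}" by auto
    finally show ?thesis .
  qed
  then have "(\<Sum>y\<in>set_pmf (map_pmf f p). pmf (map_pmf f p) y * g y)
    = (\<Sum>y\<in>f ` set_pmf p. \<Sum>x\<in>{x\<in>set_pmf p. f x = y}. pmf p x * g (f x))"
    by (simp add: sum_distrib_right)
  also have "\<dots> = (\<Sum>x\<in>set_pmf p. pmf p x * g (f x))"
    using assms by (subst sum.image_gen[of _ _ f]) auto
  finally show ?thesis .
qed

lemma H_expect:
  assumes "finite (set_pmf p)"
  shows "H p f = (\<Sum>x\<in>set_pmf p. pmf p x * - ln (pmf (map_pmf f p) (f x)))"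
proof -
  have "H p f = (\<Sum>y\<in>set_pmf (map_pmf f p). pmf (map_pmf f p) y * - ln (pmf (map_pmf f p) y))"
    by (simp add: H_def ent_def)
  also have "\<dots> = (\<Sum>x\<in>set_pmf p. pmf p x * - ln (pmf (map_pmf f p) (f x)))"
    by (rule sum_pmf_map[OF assms])
  finally show ?thesis .
qed

lemma sum_pmf_set [simp]: "finite (set_pmf p) \<Longrightarrow> (\<Sum>x\<in>set_pmf p. pmf p x) = 1"
  by (rule sum_pmf_eq_1) auto

lemma H_map [simp]: "H (map_pmf g p) f = H p (\<lambda>x. f (g x))"
  by (simp add: H_def map_pmf_comp)

lemma H_id [simp]: "H p id = ent p" "H p (\<lambda>x. x) = ent p"
  by (simp_all add: H_def)

lemma ent_map: "ent (map_pmf f p) = H p f"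
  by (simp add: H_def)

lemma pmf_map_pos: "x \<in> set_pmf p \<Longrightarrow> 0 < pmf (map_pmf f p) (f x)"
  by (metis imageI pmf_positive set_map_pmf)

lemma H_cong: "(\<And>x. x \<in> set_pmf p \<Longrightarrow> f x = g x) \<Longrightarrow> H p f = H p g"
  unfolding H_def by (metis (mono_tags, lifting) map_pmf_cong)

text \<open>The fibre of the composite through a point contains the fibre of \<open>f\<close>, so
  the inequality holds for the surprisal at every point, before averaging.\<close>

lemma H_comp_le:
  assumes "finite (set_pmf p)"
  shows "H p (\<lambda>x. g (f x)) \<le> H p f"
proof -
  have "ln (pmf (map_pmf f p) (f x)) \<le> ln (pmf (map_pmf (\<lambda>x. g (f x)) p) (g (f x)))"
    if "x \<in> set_pmf p" for x
  proof -
    have "measure p (f -` {f x}) \<le> measure p ((\<lambda>x. g (f x)) -` {g (f x)})"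
      by (rule measure_pmf.finite_measure_mono) auto
    then show ?thesis
      using pmf_map_pos[OF that, of f] by (simp add: pmf_map)
  qed
  then show ?thesis
    unfolding H_expect[OF assms] by (intro sum_mono mult_left_mono) auto
qed

lemma H_mono:
  assumes "finite (set_pmf p)" "\<And>x. x \<in> set_pmf p \<Longrightarrow> f x = h (g x)"
  shows "H p f \<le> H p g"
proof -
  have "H p f = H p (\<lambda>x. h (g x))" by (rule H_cong) (rule assms)
  then show ?thesis using H_comp_le[OF assms(1), of h g] by simp
qed

text \<open>Change of variables: in every later use \<open>h\<close> and \<open>k\<close> are
  explicit maps recovering each tuple from the other, so tuples carrying the same information can be
  interchanged.\<close>

lemma H_eqI:
  assumes "finite (set_pmf p)"
    "\<And>x. x \<in> set_pmf p \<Longrightarrow> f x = h (g x)" "\<And>x. x \<in> set_pmf p \<Longrightarrow> g x = k (f x)"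
  shows "H p f = H p g"
proof (rule antisym)
  show "H p f \<le> H p g" by (rule H_mono[where h = h]) (fact assms)+
  show "H p g \<le> H p f" by (rule H_mono[where h = k]) (fact assms)+
qed

lemma ent_nonneg [simp]: "0 \<le> ent p"
  unfolding ent_def
  by (intro sum_nonneg) (simp add: mult_nonneg_nonpos pmf_le_1 pmf_nonneg pmf_positive_iff)

lemma H_nonneg [simp]: "0 \<le> H p f"
  by (simp add: H_def)

text \<open>Gibbs' inequality against the uniform law on \<open>B\<close>, from ln t \<le> t -
  1.\<close>

lemma ent_le_ln_card:
  assumes "finite B" "set_pmf p \<subseteq> B"
  shows "ent p \<le> ln (card B)"
proof -
  have f: "finite (set_pmf p)" and c: "card B > 0"
    using assms finite_subset set_pmf_not_empty by (fastforce simp: card_gt_0_iff)+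
  have "ent p - ln (card B) = (\<Sum>x\<in>set_pmf p. pmf p x * (- ln (pmf p x) - ln (card B)))"
    using f unfolding ent_def right_diff_distrib sum_subtractf
    by (simp flip: sum_distrib_right)
  also have "\<dots> \<le> (\<Sum>x\<in>set_pmf p. pmf p x * (1 / (pmf p x * card B) - 1))"
  proof (intro sum_mono mult_left_mono)
    fix x assume "x \<in> set_pmf p"
    then have p: "pmf p x > 0" by (rule pmf_positive)
    have "ln (1 / (pmf p x * card B)) \<le> 1 / (pmf p x * card B) - 1"
      using p c by (intro ln_le_minus_one) auto
    then show "- ln (pmf p x) - ln (card B) \<le> 1 / (pmf p x * card B) - 1"
      using p c by (simp add: ln_div ln_mult)
  qed auto
  also have "\<dots> = (\<Sum>x\<in>set_pmf p. 1 / card B) - 1"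
    using f c unfolding right_diff_distrib sum_subtractf
    by (intro arg_cong2[where f = minus] sum.cong) (auto simp: set_pmf_iff)
  also have "\<dots> \<le> 0"
    using c card_mono[OF assms] by (simp add: field_simps)
  finally show ?thesis by simp
qed

text \<open>The weight \<open>q\<close> makes the first two coordinates conditionally independent
  given the third, with the pair marginals of \<open>p\<close>. The right side minus the left is the
  relative entropy of \<open>p\<close> to \<open>q\<close>; it is nonnegative by ln t \<le> t - 1,
  because \<open>q\<close> has mass at most 1 on the support of \<open>p\<close>.\<close>

lemma submodular_ent:
  fixes p :: "('a \<times> 'b \<times> 'c) pmf"
  assumes fin: "finite (set_pmf p)"
  shows "H p (\<lambda>(x,y,z). (x,y,z)) + H p (\<lambda>(x,y,z). z)
     \<le> H p (\<lambda>(x,y,z). (x,z)) + H p (\<lambda>(x,y,z). (y,z))"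
proof -
  define pxz where "pxz = map_pmf (\<lambda>(x,y,z). (x,z)) p"
  define pyz where "pyz = map_pmf (\<lambda>(x,y,z). (y,z)) p"
  define pz where "pz = map_pmf (\<lambda>(x,y,z). z) p"
  define q where "q = (\<lambda>(x,y,z). pmf pxz (x,z) * pmf pyz (y,z) / pmf pz z)"
  have zx: "pz = map_pmf snd pxz" and zy: "pz = map_pmf snd pyz"
    by (simp_all add: pz_def pxz_def pyz_def map_pmf_comp case_prod_unfold)
  have finxz: "finite (set_pmf pxz)" and finyz: "finite (set_pmf pyz)" and finz: "finite (set_pmf pz)"
    using fin by (auto simp: pxz_def pyz_def pz_def)
  have pos: "0 < pmf pxz (x,z)" "0 < pmf pyz (y,z)" "0 < pmf pz z" if "(x,y,z) \<in> set_pmf p" for x y z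
    using pmf_map_pos[OF that, of "\<lambda>(x,y,z). (x,z)"] pmf_map_pos[OF that, of "\<lambda>(x,y,z). (y,z)"]
      pmf_map_pos[OF that, of "\<lambda>(x,y,z). z"] by (simp_all add: pxz_def pyz_def pz_def)
  \<comment> \<open>The sum is enlarged to all triples whose projections (x, z) and (y, z) lie in
    the marginal supports; the inner sum over y then cancels the denominator
    \<open>pmf pz z\<close>.\<close>
  have "(\<Sum>w\<in>set_pmf p. q w) \<le> (\<Sum>w\<in>(\<lambda>((x,z),y). (x,y,z)) ` (SIGMA v:set_pmf pxz. {y. (y, snd v) \<in> set_pmf pyz}). q w)"
  proof (intro sum_mono2)
    have "(SIGMA v:set_pmf pxz. {y. (y, snd v) \<in> set_pmf pyz}) \<subseteq> set_pmf pxz \<times> fst ` set_pmf pyz"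
      by (force simp: image_iff)
    then show "finite ((\<lambda>((x,z),y). (x,y,z)) ` (SIGMA v:set_pmf pxz. {y. (y, snd v) \<in> set_pmf pyz}))"
      using finxz finyz by (meson finite_SigmaI finite_imageI finite_subset)
    show "set_pmf p \<subseteq> (\<lambda>((x,z),y). (x,y,z)) ` (SIGMA v:set_pmf pxz. {y. (y, snd v) \<in> set_pmf pyz})"
    proof (clarify)
      fix x y z assume "(x,y,z) \<in> set_pmf p"
      then have "(x,z) \<in> set_pmf pxz" "(y,z) \<in> set_pmf pyz"
        by (force simp: pxz_def pyz_def)+
      then show "(x,y,z) \<in> (\<lambda>((x,z),y). (x,y,z)) ` (SIGMA v:set_pmf pxz. {y. (y, snd v) \<in> set_pmf pyz})"
        by (intro image_eqI[of _ _ "((x,z),y)"]) auto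
    qed
  qed (auto simp: q_def)
  also have "\<dots> = (\<Sum>((x,z),y)\<in>(SIGMA v:set_pmf pxz. {y. (y, snd v) \<in> set_pmf pyz}). q (x,y,z))"
    by (subst sum.reindex) (auto simp: inj_on_def case_prod_unfold)
  also have "\<dots> = (\<Sum>(x,z)\<in>set_pmf pxz. \<Sum>y\<in>{y. (y, z) \<in> set_pmf pyz}. q (x,y,z))"
  proof (subst sum.Sigma[symmetric])
    show "\<forall>v\<in>set_pmf pxz. finite {y. (y, snd v) \<in> set_pmf pyz}"
    proof
      fix v
      have "{y. (y, snd v) \<in> set_pmf pyz} \<subseteq> fst ` set_pmf pyz" by force
      then show "finite {y. (y, snd v) \<in> set_pmf pyz}" using finyz finite_subset by blast
    qed
  qed (use finxz in \<open>auto simp: case_prod_unfold\<close>)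
  also have "\<dots> = (\<Sum>(x,z)\<in>set_pmf pxz. pmf pxz (x,z))"
  proof (intro sum.cong refl, clarify)
    fix x z assume "(x,z) \<in> set_pmf pxz"
    then have "z \<in> set_pmf pz" by (force simp: zx)
    then have pz: "pmf pz z > 0" by (rule pmf_positive)
    have *: "(\<lambda>y. (y,z)) ` {y. (y,z) \<in> set_pmf pyz} = snd -` {z} \<inter> set_pmf pyz" by auto
    have "(\<Sum>y\<in>{y. (y, z) \<in> set_pmf pyz}. pmf pyz (y,z)) = sum (pmf pyz) ((\<lambda>y. (y,z)) ` {y. (y,z) \<in> set_pmf pyz})"
      by (subst sum.reindex) (auto simp: inj_on_def)
    also have "\<dots> = measure pyz (snd -` {z} \<inter> set_pmf pyz)"
      unfolding * using finyz by (intro measure_measure_pmf_finite[symmetric]) auto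
    also have "\<dots> = pmf pz z"
      by (simp add: zy pmf_map measure_Int_set_pmf)
    finally have "(\<Sum>y\<in>{y. (y, z) \<in> set_pmf pyz}. pmf pyz (y,z)) = pmf pz z" .
    then show "(\<Sum>y\<in>{y. (y, z) \<in> set_pmf pyz}. q (x,y,z)) = pmf pxz (x,z)"
      using pz by (simp add: q_def flip: sum_distrib_left sum_divide_distrib)
  qed
  also have "\<dots> = 1" using finxz by (simp add: case_prod_unfold)
  finally have q1: "(\<Sum>w\<in>set_pmf p. q w) \<le> 1" .
  have "H p (\<lambda>(x,y,z). (x,y,z)) + H p (\<lambda>(x,y,z). z) - H p (\<lambda>(x,y,z). (x,z)) - H p (\<lambda>(x,y,z). (y,z))
    = (\<Sum>w\<in>set_pmf p. pmf p w * ln (q w / pmf p w))"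
    unfolding H_expect[OF fin] sum.distrib[symmetric] sum_subtractf[symmetric]
  proof (intro sum.cong refl, clarify)
    fix x y z assume w: "(x,y,z) \<in> set_pmf p"
    have ne: "pmf pxz (x,z) \<noteq> 0" "pmf pyz (y,z) \<noteq> 0" "pmf pz z \<noteq> 0" "pmf p (x,y,z) \<noteq> 0"
      using pos[OF w] pmf_positive[OF w] by auto
    have "map_pmf (\<lambda>(x,y,z). (x,y,z)) p = p" by (simp add: case_prod_unfold)
    then show "pmf p (x, y, z) * - ln (pmf (map_pmf (\<lambda>(x, y, z). (x, y, z)) p) (x, y, z)) +
       pmf p (x, y, z) * - ln (pmf (map_pmf (\<lambda>(x, y, z). z) p) z) -
       pmf p (x, y, z) * - ln (pmf (map_pmf (\<lambda>(x, y, z). (x, z)) p) (x, z)) -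
       pmf p (x, y, z) * - ln (pmf (map_pmf (\<lambda>(x, y, z). (y, z)) p) (y, z)) =
       pmf p (x, y, z) * ln (q (x, y, z) / pmf p (x, y, z))"
      unfolding pxz_def[symmetric] pyz_def[symmetric] pz_def[symmetric]
      using ne by (simp add: q_def ln_div ln_mult algebra_simps)
  qed
  also have "\<dots> \<le> (\<Sum>w\<in>set_pmf p. pmf p w * (q w / pmf p w - 1))"
  proof (intro sum_mono mult_left_mono, clarify)
    fix x y z assume w: "(x,y,z) \<in> set_pmf p"
    show "ln (q (x,y,z) / pmf p (x,y,z)) \<le> q (x,y,z) / pmf p (x,y,z) - 1"
      using pos[OF w] pmf_positive[OF w] by (intro ln_le_minus_one) (simp add: q_def)
  qed auto
  also have "\<dots> = (\<Sum>w\<in>set_pmf p. q w - pmf p w)"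
    by (intro sum.cong refl) (auto simp: field_simps set_pmf_iff)
  also have "\<dots> \<le> 0" using q1 fin by (simp add: sum_subtractf)
  finally show ?thesis by simp
qed

lemma H_submodular:
  assumes "finite (set_pmf p)"
  shows "H p (\<lambda>w. (f w, g w, h w)) + H p h \<le> H p (\<lambda>w. (f w, h w)) + H p (\<lambda>w. (g w, h w))"
  using submodular_ent[of "map_pmf (\<lambda>w. (f w, g w, h w)) p"] assms by (simp add: ent_map)

lemma ent_pair_pmf:
  assumes "finite (set_pmf p)" "finite (set_pmf q)"
  shows "ent (pair_pmf p q) = ent p + ent q"
proof -
  have "ent (pair_pmf p q) = (\<Sum>(x,y)\<in>set_pmf p \<times> set_pmf q. pmf p x * pmf q y * (- ln (pmf p x) - ln (pmf q y)))"
    unfolding ent_def by (auto intro!: sum.cong simp: pmf_pair ln_mult set_pmf_iff algebra_simps)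
  also have "\<dots> = (\<Sum>x\<in>set_pmf p. \<Sum>y\<in>set_pmf q. (- pmf p x * ln (pmf p x)) * pmf q y + pmf p x * (- pmf q y * ln (pmf q y)))"
    unfolding sum.cartesian_product[symmetric] by (intro sum.cong refl) (simp add: algebra_simps)
  also have "\<dots> = (\<Sum>x\<in>set_pmf p. - pmf p x * ln (pmf p x) + pmf p x * ent q)"
    using assms by (intro sum.cong refl)
      (simp only: sum.distrib sum_distrib_left[symmetric] sum_pmf_set ent_def mult_1_right)
  also have "\<dots> = ent p + ent q"
    unfolding sum.distrib sum_distrib_right[symmetric] using assms by (simp add: ent_def)
  finally show ?thesis .
qed

lemma map_pair_pmf: "map_pmf (\<lambda>w. (f (fst w), g (snd w))) (pair_pmf p q) = pair_pmf (map_pmf f p) (map_pmf g q)"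
  unfolding map_pair[symmetric] by (simp add: case_prod_unfold map_prod_def)

lemma H_pair_indep:
  assumes "finite (set_pmf p)" "finite (set_pmf q)"
  shows "H (pair_pmf p q) (\<lambda>w. (f (fst w), g (snd w))) = H p f + H q g"
  unfolding H_def map_pair_pmf using assms by (simp add: ent_pair_pmf)

lemma H_pair_fst: "H (pair_pmf p q) (\<lambda>w. f (fst w)) = H p f"
  by (metis H_map map_fst_pair_pmf)

lemma H_pair_snd: "H (pair_pmf p q) (\<lambda>w. f (snd w)) = H q f"
  by (metis H_map map_snd_pair_pmf)

section \<open>Labelled variables, sums and fibres\<close>

text \<open>Addition and subtraction coincide here. The entropic part of the argument is carried out
  at this generality; \<open>nat \<Rightarrow> bit\<close> enters only with the quotient
  maps.\<close>

class boolean_group = ab_group_add +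
  assumes add_self [simp]: "a + a = 0"
begin

lemma add_self_left [simp]: "a + (a + b) = b"
  by (metis add_assoc add_self add_0_left)

end

lemma pair_map_map_pmf: "pair_pmf (map_pmf f p) (map_pmf g q) = map_pmf (\<lambda>w. (f (fst w), g (snd w))) (pair_pmf p q)"
  by (simp add: map_pair_pmf)

lemma pair_pair_swap:
  "map_pmf (\<lambda>w. ((fst (fst w), fst (snd w)), (snd (fst w), snd (snd w)))) (pair_pmf (pair_pmf p q) (pair_pmf r s))
    = pair_pmf (pair_pmf p r) (pair_pmf q s)"
  unfolding pair_pmf_def map_bind_pmf bind_assoc_pmf bind_return_pmf map_return_pmf fst_conv snd_conv
  by (subst (2) bind_commute_pmf) (rule refl)

definition conv :: "'g::boolean_group pmf \<Rightarrow> 'g pmf \<Rightarrow> 'g pmf"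
  where "conv p q = map_pmf (\<lambda>w. fst w + snd w) (pair_pmf p q)"

text \<open>A label is a binary tree of past conditionings: a node stores the value of a sum and the
  labels of the two copies involved.\<close>

datatype 'g label = Leaf | Node (val: 'g) (left: "'g label") (right: "'g label")

type_synonym 'g lvar = "('g \<times> 'g label) pmf"

definition cond_ent :: "('g \<times> 'l) pmf \<Rightarrow> real"
  where "cond_ent P = ent P - H P snd"

text \<open>The joint entropy H(Y + Y', Z, Z') of two independent copies of (Y, Z), labels
  included.\<close>

definition sum_ent :: "('g::boolean_group \<times> 'l) pmf \<Rightarrow> real"
  where "sum_ent P = H (pair_pmf P P) (\<lambda>w. (fst (fst w) + fst (snd w), snd (fst w), snd (snd w)))"

text \<open>This is H(Y + Y' | Z, Z') - H(Y | Z): the two labels are independent, so their joint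
  entropy is twice \<open>H P snd\<close>.\<close>

definition cond_doubling :: "('g::boolean_group \<times> 'l) pmf \<Rightarrow> real"
  where "cond_doubling P = sum_ent P - 2 * H P snd - cond_ent P"

text \<open>The \<open>0\<close> in \<open>Node 0\<close> is a dummy: a single label type is closed under both operations.\<close>

definition sum_lvar :: "'g::boolean_group lvar \<Rightarrow> 'g lvar"
  where "sum_lvar P = map_pmf (\<lambda>w. (fst (fst w) + fst (snd w), Node 0 (snd (fst w)) (snd (snd w)))) (pair_pmf P P)"

definition fib_lvar :: "'g::boolean_group lvar \<Rightarrow> 'g lvar"
  where "fib_lvar P = map_pmf (\<lambda>w. (fst (fst w), Node (fst (fst w) + fst (snd w)) (snd (fst w)) (snd (snd w)))) (pair_pmf P P)"

lemma finite_set_sum_lvar [simp]: "finite (set_pmf P) \<Longrightarrow> finite (set_pmf (sum_lvar P))"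
  and finite_set_fib_lvar [simp]: "finite (set_pmf P) \<Longrightarrow> finite (set_pmf (fib_lvar P))"
  and finite_set_conv [simp]: "finite (set_pmf p) \<Longrightarrow> finite (set_pmf q) \<Longrightarrow> finite (set_pmf (conv p q))"
  by (auto simp: sum_lvar_def fib_lvar_def conv_def)

lemma fst_sum_lvar: "map_pmf fst (sum_lvar P) = conv (map_pmf fst P) (map_pmf fst P)"
  by (simp add: sum_lvar_def conv_def map_pmf_comp pair_map_map_pmf)

lemma fst_fib_lvar: "map_pmf fst (fib_lvar P) = map_pmf fst P"
proof -
  have "map_pmf fst (fib_lvar P) = map_pmf fst (map_pmf fst (pair_pmf P P))"
    by (simp only: fib_lvar_def map_pmf_comp fst_conv)
  then show ?thesis by (simp add: map_fst_pair_pmf)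
qed

section \<open>Four independent copies and the fibring identity\<close>

abbreviation "y1 \<equiv> \<lambda>w. fst (fst (fst w))"
abbreviation "y2 \<equiv> \<lambda>w. fst (snd (fst w))"
abbreviation "y3 \<equiv> \<lambda>w. fst (fst (snd w))"
abbreviation "y4 \<equiv> \<lambda>w. fst (snd (snd w))"
abbreviation "zz \<equiv> \<lambda>w. (snd (fst (fst w)), snd (snd (fst w)), snd (fst (snd w)), snd (snd (snd w)))"

definition quad :: "'a pmf \<Rightarrow> (('a \<times> 'a) \<times> ('a \<times> 'a)) pmf"
  where "quad P = pair_pmf (pair_pmf P P) (pair_pmf P P)"

lemma finite_set_quad [simp]: "finite (set_pmf P) \<Longrightarrow> finite (set_pmf (quad P))"
  by (simp add: quad_def)

lemma H_quad_swap12: "H (quad P) f = H (quad P) (\<lambda>w. f ((snd (fst w), fst (fst w)), snd w))"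
proof -
  have "quad P = pair_pmf (map_pmf (\<lambda>w. (snd w, fst w)) (pair_pmf P P)) (map_pmf id (pair_pmf P P))"
    unfolding quad_def by (subst pair_commute_pmf) (simp add: case_prod_unfold)
  also have "\<dots> = map_pmf (\<lambda>w. ((snd (fst w), fst (fst w)), snd w)) (quad P)"
    unfolding pair_map_map_pmf quad_def by simp
  finally have "quad P = map_pmf (\<lambda>w. ((snd (fst w), fst (fst w)), snd w)) (quad P)" .
  from arg_cong[OF this, of "\<lambda>q. H q f"] show ?thesis by (simp only: H_map)
qed

lemma H_quad_swap23: "H (quad P) f = H (quad P) (\<lambda>w. f ((fst (fst w), fst (snd w)), (snd (fst w), snd (snd w))))"
  using arg_cong[OF pair_pair_swap[of P P P P], of "\<lambda>q. H q f"] by (simp only: H_map quad_def)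

definition sum_ent4 :: "('g::boolean_group \<times> 'l) pmf \<Rightarrow> real"
  where "sum_ent4 P = H (quad P) (\<lambda>w. (y1 w + y2 w + y3 w + y4 w, zz w))"

text \<open>The three sums generate all pair sums, so this is also the \<open>sum_ent\<close> of the
  fibre variable; \<open>cond_doubling_fib\<close> uses it in that role.\<close>

definition diff_ent :: "('g::boolean_group \<times> 'l) pmf \<Rightarrow> real"
  where "diff_ent P = H (quad P) (\<lambda>w. (y1 w + y2 w, y2 w + y3 w, y1 w + y2 w + y3 w + y4 w, zz w))"

text \<open>By the symmetry of the four copies this is the conditional mutual information of \<open>Y1 + Y2\<close> and
  \<open>Y2 + Y3\<close> (equivalently of any two of the three pair sums) given \<open>Y1 + Y2 + Y3 + Y4\<close> and the labels.\<close>

definition fib_info :: "('g::boolean_group \<times> 'l) pmf \<Rightarrow> real"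
  where "fib_info P = 4 * sum_ent P - sum_ent4 P - diff_ent P"

lemma H_two_labels: "finite (set_pmf P) \<Longrightarrow> H (pair_pmf P P) (\<lambda>w. (snd (fst w), snd (snd w))) = 2 * H P snd"
  using H_pair_indep[of P P snd snd] by simp

lemma cond_ent_sum:
  assumes "finite (set_pmf P)"
  shows "cond_ent (sum_lvar P) = cond_ent P + cond_doubling P"
proof -
  have "H (pair_pmf P P) (\<lambda>w. (fst (fst w) + fst (snd w), Node 0 (snd (fst w)) (snd (snd w)))) = sum_ent P"
    unfolding sum_ent_def using assms
    by (intro H_eqI[where h = "\<lambda>(a,b,c). (a, Node 0 b c)" and k = "\<lambda>(a,l). (a, left l, right l)"]) auto
  moreover have "H (pair_pmf P P) (\<lambda>w. Node 0 (snd (fst w)) (snd (snd w))) = 2 * H P snd"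
    unfolding H_two_labels[OF assms, symmetric] using assms
    by (intro H_eqI[where h = "\<lambda>(b,c). Node 0 b c" and k = "\<lambda>l. (left l, right l)"]) auto
  ultimately show ?thesis
    by (simp add: cond_ent_def cond_doubling_def sum_lvar_def ent_map)
qed

text \<open>Y and Y + Y' recover Y', so variable and label together have entropy 2 H(Y, Z); the
  entropy of the new label alone is \<open>sum_ent P\<close>.\<close>

lemma cond_ent_fib:
  assumes "finite (set_pmf P)"
  shows "cond_ent (fib_lvar P) = cond_ent P - cond_doubling P"
proof -
  have "H (pair_pmf P P) (\<lambda>w. (fst (fst w), Node (fst (fst w) + fst (snd w)) (snd (fst w)) (snd (snd w))))
     = H (pair_pmf P P) (\<lambda>w. (fst w, snd w))"
    using assms
    by (intro H_eqI[where h = "\<lambda>((a,b),(c,d)). (a, Node (a+c) b d)" and k = "\<lambda>(a,l). ((a, left l), (a + val l, right l))"]) auto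
  also have "\<dots> = 2 * ent P"
    using H_pair_indep[of P P id id] assms by simp
  finally have "ent (fib_lvar P) = 2 * ent P"
    by (simp add: fib_lvar_def ent_map)
  moreover have "H (pair_pmf P P) (\<lambda>w. Node (fst (fst w) + fst (snd w)) (snd (fst w)) (snd (snd w))) = sum_ent P"
    unfolding sum_ent_def using assms
    by (intro H_eqI[where h = "\<lambda>(a,b,c). Node a b c" and k = "\<lambda>l. (val l, left l, right l)"]) auto
  ultimately show ?thesis
    by (simp add: cond_ent_def cond_doubling_def fib_lvar_def)
qed

lemma cond_doubling_sum:
  assumes "finite (set_pmf P)"
  shows "cond_doubling (sum_lvar P) = sum_ent4 P - sum_ent P - 2 * H P snd"
proof -
  have "sum_ent (sum_lvar P) = H (quad P) (\<lambda>w. (y1 w + y2 w + (y3 w + y4 w),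
      Node 0 (snd (fst (fst w))) (snd (snd (fst w))), Node 0 (snd (fst (snd w))) (snd (snd (snd w)))))"
    by (simp add: sum_ent_def sum_lvar_def quad_def pair_map_map_pmf)
  also have "\<dots> = sum_ent4 P"
    unfolding sum_ent4_def using assms
    by (intro H_eqI[where h = "\<lambda>(a,b,c,d,e). (a, Node 0 b c, Node 0 d e)"
          and k = "\<lambda>(a,l,m). (a, left l, right l, left m, right m)"]) (auto simp: add_ac)
  finally have "sum_ent (sum_lvar P) = sum_ent4 P" .
  moreover have "H (sum_lvar P) snd = 2 * H P snd"
    unfolding H_two_labels[OF assms, symmetric] sum_lvar_def H_map snd_conv using assms
    by (intro H_eqI[where h = "\<lambda>(b,c). Node 0 b c" and k = "\<lambda>l. (left l, right l)"]) auto
  ultimately show ?thesis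
    using cond_ent_sum[OF assms] by (simp add: cond_doubling_def)
qed

lemma H_quad_12:
  assumes "finite (set_pmf P)"
  shows "H (quad P) (\<lambda>w. (y1 w + y2 w, y1 w + y2 w + y3 w + y4 w, zz w)) = 2 * sum_ent P"
proof -
  have "H (quad P) (\<lambda>w. (y1 w + y2 w, y1 w + y2 w + y3 w + y4 w, zz w))
    = H (quad P) (\<lambda>w. ((y1 w + y2 w, snd (fst (fst w)), snd (snd (fst w))), (y3 w + y4 w, snd (fst (snd w)), snd (snd (snd w)))))"
    using assms
    by (intro H_eqI[where h = "\<lambda>((a,b,c),(d,e,f)). (a, a+d, b, c, e, f)"
          and k = "\<lambda>(a,d,b,c,e,f). ((a,b,c),(a+d,e,f))"]) (auto simp: add_ac)
  also have "\<dots> = 2 * sum_ent P"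
    using H_pair_indep[of "pair_pmf P P" "pair_pmf P P" "\<lambda>v. (fst (fst v) + fst (snd v), snd (fst v), snd (snd v))"
        "\<lambda>v. (fst (fst v) + fst (snd v), snd (fst v), snd (snd v))"] assms
    by (simp add: quad_def sum_ent_def)
  finally show ?thesis .
qed

lemma H_quad_13:
  assumes "finite (set_pmf P)"
  shows "H (quad P) (\<lambda>w. (y1 w + y3 w, y1 w + y2 w + y3 w + y4 w, zz w)) = 2 * sum_ent P"
proof -
  have "H (quad P) (\<lambda>w. (y1 w + y3 w, y1 w + y2 w + y3 w + y4 w, zz w))
     = H (quad P) (\<lambda>w. (y1 w + y2 w, y1 w + y2 w + y3 w + y4 w, zz w))"
    unfolding H_quad_swap23[of P "\<lambda>w. (y1 w + y3 w, y1 w + y2 w + y3 w + y4 w, zz w)"] using assms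
    by (intro H_eqI[where h = "\<lambda>(a,s,b,c,d,e). (a,s,b,d,c,e)" and k = "\<lambda>(a,s,b,c,d,e). (a,s,b,d,c,e)"])
       (auto simp: add_ac)
  then show ?thesis using H_quad_12[OF assms] by simp
qed

lemma H_quad_23:
  assumes "finite (set_pmf P)"
  shows "H (quad P) (\<lambda>w. (y2 w + y3 w, y1 w + y2 w + y3 w + y4 w, zz w)) = 2 * sum_ent P"
proof -
  have "H (quad P) (\<lambda>w. (y2 w + y3 w, y1 w + y2 w + y3 w + y4 w, zz w))
     = H (quad P) (\<lambda>w. (y1 w + y3 w, y1 w + y2 w + y3 w + y4 w, zz w))"
    unfolding H_quad_swap12[of P "\<lambda>w. (y2 w + y3 w, y1 w + y2 w + y3 w + y4 w, zz w)"] using assms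
    by (intro H_eqI[where h = "\<lambda>(a,s,b,c,d,e). (a,s,c,b,d,e)" and k = "\<lambda>(a,s,b,c,d,e). (a,s,c,b,d,e)"])
       (auto simp: add_ac)
  then show ?thesis using H_quad_13[OF assms] by simp
qed

text \<open>Two copies of the fibre variable carry Y1 + Y2 and Y3 + Y4 in their labels. Their sum Y1
  + Y3 with these labels is equivalent to the tuple in \<open>diff_ent\<close>.\<close>

lemma cond_doubling_fib:
  assumes "finite (set_pmf P)"
  shows "cond_doubling (fib_lvar P) = diff_ent P - 2 * sum_ent P - cond_ent P + cond_doubling P"
proof -
  have "sum_ent (fib_lvar P) = H (quad P) (\<lambda>w. (y1 w + y3 w,
      Node (y1 w + y2 w) (snd (fst (fst w))) (snd (snd (fst w))), Node (y3 w + y4 w) (snd (fst (snd w))) (snd (snd (snd w)))))"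
    by (simp add: sum_ent_def fib_lvar_def quad_def pair_map_map_pmf)
  also have "\<dots> = diff_ent P"
    unfolding diff_ent_def using assms
    by (intro H_eqI[where h = "\<lambda>(a,b,s,c,d,e,f). (a+b, Node a c d, Node (a+s) e f)"
          and k = "\<lambda>(a,l,m). (val l, val l + a, val l + val m, left l, right l, left m, right m)"])
       (auto simp: add_ac)
  finally have "sum_ent (fib_lvar P) = diff_ent P" .
  moreover have "H (fib_lvar P) snd = sum_ent P"
    unfolding sum_ent_def fib_lvar_def H_map snd_conv using assms
    by (intro H_eqI[where h = "\<lambda>(a,b,c). Node a b c" and k = "\<lambda>l. (val l, left l, right l)"]) auto
  ultimately show ?thesis
    using cond_ent_fib[OF assms] by (simp add: cond_doubling_def)
qed

text \<open>With the closed forms for the sum and the fibre in place, everything but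
  \<open>fib_info\<close> cancels. The point is that \<open>fib_info P\<close> must be small
  whenever neither the sum nor the fibre has noticeably smaller doubling.\<close>

lemma fibring:
  assumes "finite (set_pmf P)"
  shows "cond_doubling (sum_lvar P) + cond_doubling (fib_lvar P) + fib_info P = 2 * cond_doubling P"
  unfolding cond_doubling_sum[OF assms] cond_doubling_fib[OF assms] fib_info_def by (simp add: cond_doubling_def)

lemma cond_ent_nonneg:
  assumes "finite (set_pmf P)"
  shows "0 \<le> cond_ent P"
  unfolding cond_ent_def using H_comp_le[OF assms, of snd "\<lambda>x. x"] by simp

text \<open>Given Y' and the labels, Y + Y' has the entropy of Y given its label, and conditioning
  cannot increase entropy.\<close>

lemma cond_doubling_nonneg:
  assumes "finite (set_pmf P)"
  shows "0 \<le> cond_doubling P"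
proof -
  let ?Q = "pair_pmf P P"
  have "H ?Q (\<lambda>w. (fst (fst w) + fst (snd w), fst (snd w), snd (fst w), snd (snd w))) + H ?Q (\<lambda>w. (snd (fst w), snd (snd w)))
    \<le> sum_ent P + H ?Q (\<lambda>w. (fst (snd w), snd (fst w), snd (snd w)))"
    unfolding sum_ent_def using assms by (intro H_submodular) simp
  moreover have "H ?Q (\<lambda>w. (fst (fst w) + fst (snd w), fst (snd w), snd (fst w), snd (snd w))) = H ?Q (\<lambda>w. (fst w, snd w))"
    using assms
    by (intro H_eqI[where h = "\<lambda>((a,b),(c,d)). (a+c,c,b,d)" and k = "\<lambda>(a,c,b,d). ((a+c,b),(c,d))"]) (auto simp: add_ac)
  moreover have "H ?Q (\<lambda>w. (fst w, snd w)) = 2 * ent P"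
    using H_pair_indep[of P P id id] assms by simp
  moreover have "H ?Q (\<lambda>w. (fst (snd w), snd (fst w), snd (snd w))) = H ?Q (\<lambda>w. (snd (fst w), snd w))"
    using assms
    by (intro H_eqI[where h = "\<lambda>(b,c,d). (c,b,d)" and k = "\<lambda>(c,b,d). (b,c,d)"]) auto
  moreover have "H ?Q (\<lambda>w. (snd (fst w), snd w)) = H P snd + ent P"
    using H_pair_indep[of P P snd id] assms by simp
  ultimately show ?thesis
    using H_two_labels[OF assms] by (simp add: cond_doubling_def cond_ent_def)
qed

lemma fib_info_nonneg:
  assumes "finite (set_pmf P)"
  shows "0 \<le> fib_info P"
  using H_submodular[OF finite_set_quad[OF assms], of "\<lambda>w. y1 w + y2 w" "\<lambda>w. y2 w + y3 w" "\<lambda>w. (y1 w + y2 w + y3 w + y4 w, zz w)"]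
    H_quad_12[OF assms] H_quad_23[OF assms]
  by (simp add: fib_info_def sum_ent4_def diff_ent_def)

text \<open>\<open>H(R | R + Y, Z)\<close> for \<open>R\<close> with law \<open>r\<close> independent of \<open>(Y, Z)\<close>, since then
  \<open>H(R, R + Y, Z) = H(R) + H(Y, Z)\<close>.\<close>

definition cond_gain :: "'g::boolean_group pmf \<Rightarrow> ('g \<times> 'l) pmf \<Rightarrow> real"
  where "cond_gain r P = ent r + ent P - H (pair_pmf r P) (\<lambda>w. (fst w + fst (snd w), snd (snd w)))"

lemma H_snd_le: "finite (set_pmf p) \<Longrightarrow> finite (set_pmf q) \<Longrightarrow> H (pair_pmf p q) (\<lambda>w. (fst w, g (snd w))) = ent p + H q g"
  using H_pair_indep[of p q id g] by simp

lemma cond_gain_le: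
  assumes "finite (set_pmf r)" "finite (set_pmf P)"
  shows "cond_gain r P \<le> ent r"
proof -
  let ?Q = "pair_pmf r P"
  have "H ?Q (\<lambda>w. (fst w + fst (snd w), fst w, snd (snd w))) + H ?Q (\<lambda>w. snd (snd w))
    \<le> H ?Q (\<lambda>w. (fst w + fst (snd w), snd (snd w))) + H ?Q (\<lambda>w. (fst w, snd (snd w)))"
    using assms by (intro H_submodular) simp
  moreover have "H ?Q (\<lambda>w. (fst w + fst (snd w), fst w, snd (snd w))) = H ?Q (\<lambda>w. (fst w, snd w))"
    using assms
    by (intro H_eqI[where h = "\<lambda>(a,b,c). (a+b,a,c)" and k = "\<lambda>(s,a,c). (a,a+s,c)"]) (auto simp: add_ac)
  moreover have "H ?Q (\<lambda>w. (fst w, snd w)) = ent r + ent P" 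
    using H_snd_le[OF assms, of id] by simp
  moreover have "H ?Q (\<lambda>w. snd (snd w)) = H P snd" by (rule H_pair_snd)
  moreover have "H ?Q (\<lambda>w. (fst w, snd (snd w))) = ent r + H P snd" by (rule H_snd_le[OF assms])
  ultimately show ?thesis by (simp add: cond_gain_def)
qed

lemma H_pair_map_right: "H (pair_pmf r (map_pmf g q)) f = H (pair_pmf r q) (\<lambda>w. f (fst w, g (snd w)))"
  using H_map[of "\<lambda>w. (id (fst w), g (snd w))" "pair_pmf r q" f] unfolding map_pair_pmf pmf.map_id by simp

text \<open>H(R | R + Y, Z) equals H(R | R + Y + Y', Y', Z, Z'), and dropping Y' from the conditions
  can only raise it.\<close>

lemma cond_gain_sum:
  assumes "finite (set_pmf r)" "finite (set_pmf P)"
  shows "cond_gain r P \<le> cond_gain r (sum_lvar P)"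
proof -
  let ?Q = "pair_pmf r (pair_pmf P P)"
  let ?a = "\<lambda>w. fst w" and ?b = "\<lambda>w. fst (fst (snd w))" and ?c = "\<lambda>w. fst (snd (snd w))"
    and ?z = "\<lambda>w. (snd (fst (snd w)), snd (snd (snd w)))"
  have "H ?Q (\<lambda>w. (?a w, ?c w, ?a w + ?b w + ?c w, ?z w)) + H ?Q (\<lambda>w. (?a w + ?b w + ?c w, ?z w))
    \<le> H ?Q (\<lambda>w. (?a w, ?a w + ?b w + ?c w, ?z w)) + H ?Q (\<lambda>w. (?c w, ?a w + ?b w + ?c w, ?z w))"
    using assms by (intro H_submodular) simp
  moreover have "H ?Q (\<lambda>w. (?a w, ?c w, ?a w + ?b w + ?c w, ?z w)) = H ?Q (\<lambda>w. (fst w, snd w))"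
    using assms
    by (intro H_eqI[where h = "\<lambda>(a,(b,y),(c,z)). (a,c,a+b+c,y,z)" and k = "\<lambda>(a,c,s,y,z). (a,(s+a+c,y),(c,z))"])
       (auto simp: add_ac)
  moreover have "H ?Q (\<lambda>w. (fst w, snd w)) = ent r + 2 * ent P"
    using H_snd_le[of r "pair_pmf P P" id] assms by (simp add: ent_pair_pmf)
  moreover have "H ?Q (\<lambda>w. (?a w, ?a w + ?b w + ?c w, ?z w)) = H ?Q (\<lambda>w. (fst w, (\<lambda>v. (fst (fst v) + fst (snd v), snd (fst v), snd (snd v))) (snd w)))"
    using assms
    by (intro H_eqI[where h = "\<lambda>(a,s,z). (a,a+s,z)" and k = "\<lambda>(a,s,z). (a,a+s,z)"]) (auto simp: add_ac)
  moreover have "H ?Q (\<lambda>w. (fst w, (\<lambda>v. (fst (fst v) + fst (snd v), snd (fst v), snd (snd v))) (snd w))) = ent r + sum_ent P"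
    using assms unfolding sum_ent_def by (intro H_snd_le) auto
  moreover have "H ?Q (\<lambda>w. (?c w, ?a w + ?b w + ?c w, ?z w)) = H (pair_pmf (pair_pmf r P) P) (\<lambda>w. ((fst (fst w) + fst (snd (fst w)), snd (snd (fst w))), snd w))"
    unfolding pair_pair_pmf H_map using assms
    by (intro H_eqI[where h = "\<lambda>((s,z),(c,z')). (c,s+c,z,z')" and k = "\<lambda>(c,s,z,z'). ((s+c,z),(c,z'))"])
       (auto simp: add_ac)
  moreover have "H (pair_pmf (pair_pmf r P) P) (\<lambda>w. ((fst (fst w) + fst (snd (fst w)), snd (snd (fst w))), snd w))
     = H (pair_pmf r P) (\<lambda>w. (fst w + fst (snd w), snd (snd w))) + ent P"
    using H_pair_indep[of "pair_pmf r P" P "\<lambda>w. (fst w + fst (snd w), snd (snd w))" id] assms by simp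
  moreover have "H (pair_pmf r (sum_lvar P)) (\<lambda>w. (fst w + fst (snd w), snd (snd w))) = H ?Q (\<lambda>w. (?a w + ?b w + ?c w, ?z w))"
    unfolding sum_lvar_def H_pair_map_right using assms
    by (intro H_eqI[where h = "\<lambda>(a,b,c). (a, Node 0 b c)" and k = "\<lambda>(a,l). (a, left l, right l)"])
       (auto simp: add_ac)
  moreover have "ent (sum_lvar P) = sum_ent P"
    unfolding sum_lvar_def ent_map sum_ent_def using assms
    by (intro H_eqI[where h = "\<lambda>(a,b,c). (a, Node 0 b c)" and k = "\<lambda>(a,l). (a, left l, right l)"]) auto
  ultimately show ?thesis by (simp add: cond_gain_def)
qed

lemma H_pair_map_left: "H (pair_pmf (map_pmf g q) r) f = H (pair_pmf q r) (\<lambda>w. f (g (fst w), snd w))"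
  using H_map[of "\<lambda>w. (g (fst w), id (snd w))" "pair_pmf q r" f] unfolding map_pair_pmf pmf.map_id by simp

text \<open>The loss is the information that W = (Y + Y', Z') carries about R given R + Y and Z. It
  is at most H(W | Z) - H(W | R, Y, Z), where the last term equals H(Y', Z'); this difference is the
  doubling.\<close>

lemma cond_gain_fib:
  assumes "finite (set_pmf r)" "finite (set_pmf P)"
  shows "cond_gain r P - cond_doubling P \<le> cond_gain r (fib_lvar P)"
proof -
  let ?Q = "pair_pmf r (pair_pmf P P)"
  let ?a = "\<lambda>w. fst w" and ?b = "\<lambda>w. fst (fst (snd w))" and ?c = "\<lambda>w. fst (snd (snd w))"
    and ?y = "\<lambda>w. snd (fst (snd w))" and ?z = "\<lambda>w. snd (snd (snd w))"
  have "H ?Q (\<lambda>w. (?a w + ?b w, (?b w + ?c w, ?z w), ?y w)) + H ?Q ?y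
    \<le> H ?Q (\<lambda>w. (?a w + ?b w, ?y w)) + H ?Q (\<lambda>w. ((?b w + ?c w, ?z w), ?y w))"
    using assms by (intro H_submodular) simp
  moreover have "H ?Q (\<lambda>w. (?a w + ?b w, (?b w + ?c w, ?z w), ?y w))
     = H (pair_pmf r (fib_lvar P)) (\<lambda>w. (fst w + fst (snd w), snd (snd w)))"
    unfolding fib_lvar_def H_pair_map_right using assms
    by (intro H_eqI[where k = "\<lambda>(a,(b,c),d). (a, Node b d c)" and h = "\<lambda>(a,l). (a, (val l, right l), left l)"])
       (auto simp: add_ac)
  moreover have "H ?Q ?y = H P snd"
    using H_pair_snd[of r "pair_pmf P P" "\<lambda>v. snd (fst v)"] H_pair_fst[of P P snd] by simp
  moreover have "H ?Q (\<lambda>w. (?a w + ?b w, ?y w)) = H (pair_pmf r P) (\<lambda>w. (fst w + fst (snd w), snd (snd w)))"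
    using H_pair_map_right[of r fst "pair_pmf P P" "\<lambda>w. (fst w + fst (snd w), snd (snd w))"]
    by (simp add: map_fst_pair_pmf)
  moreover have "H ?Q (\<lambda>w. ((?b w + ?c w, ?z w), ?y w)) = sum_ent P"
  proof -
    have "H ?Q (\<lambda>w. ((?b w + ?c w, ?z w), ?y w)) = H ?Q (\<lambda>w. (\<lambda>v. (fst (fst v) + fst (snd v), snd (fst v), snd (snd v))) (snd w))"
      using assms
      by (intro H_eqI[where h = "\<lambda>(a,b,c). ((a,c),b)" and k = "\<lambda>((a,c),b). (a,b,c)"]) auto
    then show ?thesis
      using H_pair_snd[of r "pair_pmf P P" "\<lambda>v. (fst (fst v) + fst (snd v), snd (fst v), snd (snd v))"]
      by (simp add: sum_ent_def)
  qed
  moreover have "ent (fib_lvar P) = 2 * ent P"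
  proof -
    have "H (fib_lvar P) snd = sum_ent P"
      unfolding sum_ent_def fib_lvar_def H_map snd_conv using assms
      by (intro H_eqI[where h = "\<lambda>(a,b,c). Node a b c" and k = "\<lambda>l. (val l, left l, right l)"]) auto
    then show ?thesis using cond_ent_fib[OF assms(2)] by (simp add: cond_ent_def cond_doubling_def)
  qed
  ultimately show ?thesis by (simp add: cond_gain_def cond_doubling_def cond_ent_def)
qed

text \<open>Here R is an independent copy of Y whose label is forgotten. Conditioning on that label
  as well lowers H(R | R + Y, Z) to the conditional entropy of the fibre variable, which
  \<open>cond_ent_fib\<close> evaluates.\<close>

lemma cond_gain_self:
  assumes "finite (set_pmf P)"
  shows "cond_ent P - cond_doubling P \<le> cond_gain (map_pmf fst P) P"
proof -
  let ?Q = "pair_pmf P P"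
  let ?h = "\<lambda>w. (fst (fst w) + fst (snd w), snd (snd w))"
  have "H ?Q (\<lambda>w. (fst (fst w), snd (fst w), ?h w)) + H ?Q ?h
    \<le> H ?Q (\<lambda>w. (fst (fst w), ?h w)) + H ?Q (\<lambda>w. (snd (fst w), ?h w))"
    using assms by (intro H_submodular) simp
  moreover have "H ?Q (\<lambda>w. (fst (fst w), snd (fst w), ?h w)) = H ?Q (\<lambda>w. (fst w, snd w))"
    using assms
    by (intro H_eqI[where h = "\<lambda>((a,b),(c,d)). (a,b,a+c,d)" and k = "\<lambda>(a,b,c,d). ((a,b),(a+c,d))"]) auto
  moreover have "H ?Q (\<lambda>w. (fst w, snd w)) = 2 * ent P"
    using H_pair_indep[of P P id id] assms by simp
  moreover have "H ?Q (\<lambda>w. (fst (fst w), ?h w)) = H ?Q (\<lambda>w. (fst (fst w), snd w))"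
    using assms
    by (intro H_eqI[where h = "\<lambda>(a,(c,d)). (a,a+c,d)" and k = "\<lambda>(a,c,d). (a,a+c,d)"]) auto
  moreover have "H ?Q (\<lambda>w. (fst (fst w), snd w)) = H P fst + ent P"
    using H_pair_indep[of P P fst id] assms by simp
  moreover have "H ?Q (\<lambda>w. (snd (fst w), ?h w)) = sum_ent P"
    unfolding sum_ent_def using assms
    by (intro H_eqI[where h = "\<lambda>(a,b,c). (b,a,c)" and k = "\<lambda>(b,a,c). (a,b,c)"]) auto
  ultimately show ?thesis
    by (simp add: cond_gain_def cond_doubling_def cond_ent_def ent_map H_pair_map_left)
qed

section \<open>Conditioning on a single label value\<close>

lemma pmf_bind_tag:
  assumes "finite (set_pmf q)"
  shows "pmf (bind_pmf q (\<lambda>w. map_pmf (\<lambda>v. (v, w)) (k w))) (v, w) = pmf q w * pmf (k w) v"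
proof -
  have *: "pmf (map_pmf (\<lambda>v. (v, w')) (k w')) (v, w) = (if w' = w then pmf (k w) v else 0)" for w'
    by (auto simp: pmf_eq_0_set_pmf inj_on_def intro!: pmf_map_inj')
  have "pmf (bind_pmf q (\<lambda>w. map_pmf (\<lambda>v. (v, w)) (k w))) (v, w)
     = (\<Sum>w'\<in>set_pmf q. pmf (map_pmf (\<lambda>v. (v, w')) (k w')) (v, w) * pmf q w')"
    unfolding pmf_bind using assms by (intro integral_measure_pmf_real) auto
  also have "\<dots> = (\<Sum>w'\<in>set_pmf q. if w' = w then pmf (k w) v * pmf q w else 0)"
    unfolding * by (intro sum.cong) auto
  also have "\<dots> = pmf q w * pmf (k w) v"
    using assms by (auto simp: set_pmf_iff)
  finally show ?thesis .
qed

text \<open>The chain rule for a mixture that remembers its component.\<close>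

lemma ent_bind_tag:
  assumes q: "finite (set_pmf q)" and k: "\<And>w. w \<in> set_pmf q \<Longrightarrow> finite (set_pmf (k w))"
  shows "ent (bind_pmf q (\<lambda>w. map_pmf (\<lambda>v. (v, w)) (k w))) = ent q + (\<Sum>w\<in>set_pmf q. pmf q w * ent (k w))"
proof -
  let ?B = "bind_pmf q (\<lambda>w. map_pmf (\<lambda>v. (v, w)) (k w))"
  have set: "set_pmf ?B = (\<lambda>(w,v). (v,w)) ` (SIGMA w:set_pmf q. set_pmf (k w))" by auto
  have "ent ?B = (\<Sum>(w,v)\<in>(SIGMA w:set_pmf q. set_pmf (k w)). - (pmf q w * pmf (k w) v) * ln (pmf q w * pmf (k w) v))"
    unfolding ent_def set by (subst sum.reindex) (auto simp: inj_on_def pmf_bind_tag[OF q] case_prod_unfold)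
  also have "\<dots> = (\<Sum>w\<in>set_pmf q. \<Sum>v\<in>set_pmf (k w). - (pmf q w * pmf (k w) v) * ln (pmf q w * pmf (k w) v))"
    using q k by (subst sum.Sigma[symmetric]) auto
  also have "\<dots> = (\<Sum>w\<in>set_pmf q. - pmf q w * ln (pmf q w) + pmf q w * ent (k w))"
  proof (intro sum.cong refl)
    fix w assume w: "w \<in> set_pmf q"
    have "(\<Sum>v\<in>set_pmf (k w). - (pmf q w * pmf (k w) v) * ln (pmf q w * pmf (k w) v))
       = (\<Sum>v\<in>set_pmf (k w). (- pmf q w * ln (pmf q w)) * pmf (k w) v + pmf q w * (- pmf (k w) v * ln (pmf (k w) v)))"
      using w by (intro sum.cong refl) (auto simp: ln_mult set_pmf_iff algebra_simps)
    also have "\<dots> = - pmf q w * ln (pmf q w) + pmf q w * ent (k w)"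
      using k[OF w] by (simp only: sum.distrib sum_distrib_left[symmetric] sum_pmf_set ent_def mult_1_right)
    finally show "(\<Sum>v\<in>set_pmf (k w). - (pmf q w * pmf (k w) v) * ln (pmf q w * pmf (k w) v))
      = - pmf q w * ln (pmf q w) + pmf q w * ent (k w)" .
  qed
  also have "\<dots> = ent q + (\<Sum>w\<in>set_pmf q. pmf q w * ent (k w))"
    by (simp only: sum.distrib ent_def)
  finally show ?thesis .
qed

lemma H_bind_tag:
  assumes q: "finite (set_pmf q)" and k: "\<And>w. w \<in> set_pmf q \<Longrightarrow> finite (set_pmf (k w))"
  shows "H (bind_pmf q (\<lambda>w. map_pmf (\<lambda>v. (v, w)) (k w))) (\<lambda>x. (f (fst x), snd x))
     = ent q + (\<Sum>w\<in>set_pmf q. pmf q w * H (k w) f)"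
proof -
  have "map_pmf (\<lambda>x. (f (fst x), snd x)) (bind_pmf q (\<lambda>w. map_pmf (\<lambda>v. (v, w)) (k w)))
      = bind_pmf q (\<lambda>w. map_pmf (\<lambda>v. (v, w)) (map_pmf f (k w)))"
    by (simp add: map_bind_pmf map_pmf_comp)
  then show ?thesis
    using ent_bind_tag[of q "\<lambda>w. map_pmf f (k w)"] assms by (simp add: H_def)
qed

definition cond_law :: "('a \<times> 'l) pmf \<Rightarrow> 'l \<Rightarrow> 'a pmf"
  where "cond_law P w = map_pmf fst (cond_pmf P {x. snd x = w})"

lemma bind_cond_law: "bind_pmf (map_pmf snd P) (\<lambda>w. map_pmf (\<lambda>v. (v, w)) (cond_law P w)) = P"
proof -
  have ne: "set_pmf P \<inter> {x. snd x = w} \<noteq> {}" if "w \<in> set_pmf (map_pmf snd P)" for w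
    using that by auto
  have "map_pmf (\<lambda>v. (v, w)) (cond_law P w) = cond_pmf P {x. snd x = w}" if "w \<in> set_pmf (map_pmf snd P)" for w
  proof -
    have "map_pmf (\<lambda>v. (v, w)) (cond_law P w) = map_pmf (\<lambda>x. x) (cond_pmf P {x. snd x = w})"
      unfolding cond_law_def map_pmf_comp by (rule map_pmf_cong) (use ne[OF that] in \<open>auto simp: set_cond_pmf\<close>)
    then show ?thesis by simp
  qed
  then have "bind_pmf (map_pmf snd P) (\<lambda>w. map_pmf (\<lambda>v. (v, w)) (cond_law P w))
     = bind_pmf (map_pmf snd P) (\<lambda>w. cond_pmf P {x. snd x = w})"
    by (intro bind_pmf_cong) auto
  also have "\<dots> = P"
    unfolding bind_map_pmf
    using bind_cond_pmf_cancel[of P P "\<lambda>x y. snd y = snd x"] by (force simp: eq_commute)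
  finally show ?thesis .
qed

lemma finite_cond_law:
  assumes "finite (set_pmf P)" "w \<in> set_pmf (map_pmf snd P)"
  shows "finite (set_pmf (cond_law P w))"
proof -
  have "set_pmf P \<inter> {x. snd x = w} \<noteq> {}" using assms by auto
  then show ?thesis using assms(1) by (simp add: cond_law_def set_cond_pmf)
qed

section \<open>The entropic Balog-Szemeredi-Gowers theorem\<close>

text \<open>The unlabelled \<open>cond_gain\<close>: H(R | R + Y) for independent R and Y.\<close>

definition gain :: "'g::boolean_group pmf \<Rightarrow> 'g pmf \<Rightarrow> real"
  where "gain r p = ent r + ent p - ent (conv r p)"

definition log_doubling :: "'g::boolean_group pmf \<Rightarrow> real"
  where "log_doubling p = ent (conv p p) - ent p"

lemma ent_cond_law:
  assumes "finite (set_pmf P)"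
  shows "ent P = H P snd + (\<Sum>w\<in>set_pmf (map_pmf snd P). pmf (map_pmf snd P) w * ent (cond_law P w))"
  using ent_bind_tag[of "map_pmf snd P" "cond_law P"] finite_cond_law[OF assms] assms
  by (simp add: bind_cond_law ent_map)

lemma pair_bind_right: "pair_pmf r (bind_pmf q f) = bind_pmf q (\<lambda>w. pair_pmf r (f w))"
  unfolding pair_pmf_def bind_assoc_pmf by (rule bind_commute_pmf)

lemma cond_gain_cond_law:
  assumes "finite (set_pmf r)" "finite (set_pmf P)"
  shows "cond_gain r P = (\<Sum>w\<in>set_pmf (map_pmf snd P). pmf (map_pmf snd P) w * gain r (cond_law P w))"
proof -
  let ?q = "map_pmf snd P"
  have "map_pmf (\<lambda>w. (fst w + fst (snd w), snd (snd w))) (pair_pmf r P)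
    = map_pmf (\<lambda>w. (fst w + fst (snd w), snd (snd w))) (pair_pmf r (bind_pmf ?q (\<lambda>w. map_pmf (\<lambda>v. (v, w)) (cond_law P w))))"
    by (simp only: bind_cond_law)
  also have "\<dots> = bind_pmf ?q (\<lambda>w. map_pmf (\<lambda>v. (v, w)) (conv r (cond_law P w)))"
    unfolding pair_bind_right map_bind_pmf
  proof (rule arg_cong[of _ _ "bind_pmf ?q"], rule ext)
    fix w
    have "pair_pmf r (map_pmf (\<lambda>v. (v, w)) (cond_law P w)) = map_pmf (\<lambda>u. (fst u, (snd u, w))) (pair_pmf r (cond_law P w))"
      using map_pair_pmf[of id "\<lambda>v. (v, w)" r "cond_law P w"] by simp
    then show "map_pmf (\<lambda>w. (fst w + fst (snd w), snd (snd w))) (pair_pmf r (map_pmf (\<lambda>v. (v, w)) (cond_law P w)))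
       = map_pmf (\<lambda>v. (v, w)) (conv r (cond_law P w))"
      by (simp add: conv_def map_pmf_comp)
  qed
  finally have "H (pair_pmf r P) (\<lambda>w. (fst w + fst (snd w), snd (snd w)))
     = ent ?q + (\<Sum>w\<in>set_pmf ?q. pmf ?q w * ent (conv r (cond_law P w)))"
    using ent_bind_tag[of ?q "\<lambda>w. conv r (cond_law P w)"] finite_cond_law[OF assms(2)] assms
    by (simp add: H_def)
  moreover have "(\<Sum>w\<in>set_pmf ?q. pmf ?q w * ent r) = ent r"
    using assms sum_pmf_set[of ?q] by (simp only: flip: sum_distrib_right) simp
  ultimately show ?thesis
    using ent_cond_law[OF assms(2)]
    by (simp add: cond_gain_def gain_def ent_map right_diff_distrib distrib_left sum.distrib sum_subtractf)
qed

text \<open>The joint law behind the Balog-Szemeredi-Gowers argument: two copies of the variable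
  that share one label and are independent given it.\<close>

definition cond_copies :: "('a \<times> 'l) pmf \<Rightarrow> (('a \<times> 'a) \<times> 'l) pmf"
  where "cond_copies P = bind_pmf (map_pmf snd P) (\<lambda>w. map_pmf (\<lambda>v. (v, w)) (pair_pmf (cond_law P w) (cond_law P w)))"

lemma cond_copies_marginals:
  "map_pmf (\<lambda>x. (fst (fst x), snd x)) (cond_copies P) = P"
  "map_pmf (\<lambda>x. (snd (fst x), snd x)) (cond_copies P) = P"
proof -
  have "map_pmf (\<lambda>x. (fst (fst x), snd x)) (cond_copies P)
    = bind_pmf (map_pmf snd P) (\<lambda>w. map_pmf (\<lambda>v. (v, w)) (map_pmf fst (pair_pmf (cond_law P w) (cond_law P w))))"
    by (simp only: cond_copies_def map_bind_pmf map_pmf_comp fst_conv snd_conv)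
  then show "map_pmf (\<lambda>x. (fst (fst x), snd x)) (cond_copies P) = P"
    by (simp only: map_fst_pair_pmf bind_cond_law)
  have "map_pmf (\<lambda>x. (snd (fst x), snd x)) (cond_copies P)
    = bind_pmf (map_pmf snd P) (\<lambda>w. map_pmf (\<lambda>v. (v, w)) (map_pmf snd (pair_pmf (cond_law P w) (cond_law P w))))"
    by (simp only: cond_copies_def map_bind_pmf map_pmf_comp fst_conv snd_conv)
  then show "map_pmf (\<lambda>x. (snd (fst x), snd x)) (cond_copies P) = P"
    by (simp only: map_snd_pair_pmf bind_cond_law)
qed

lemma H_cond_copies:
  "H (cond_copies P) (\<lambda>x. f (fst (fst x), snd x)) = H P f"
  "H (cond_copies P) (\<lambda>x. f (snd (fst x), snd x)) = H P f"
  using H_map[of "\<lambda>x. (fst (fst x), snd x)" "cond_copies P" f] H_map[of "\<lambda>x. (snd (fst x), snd x)" "cond_copies P" f]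
  by (simp_all add: cond_copies_marginals)

lemma finite_cond_copies:
  assumes "finite (set_pmf P)"
  shows "finite (set_pmf (cond_copies P))"
  using finite_cond_law[OF assms] assms by (auto simp: cond_copies_def)

text \<open>The pair of summands is \<open>A\<close> and \<open>B = A + T\<close>, where \<open>(T, C)\<close> is the label; in characteristic 2 the
  two conditional laws given \<open>T\<close> are translates of each other, so one doubling suffices.\<close>

lemma balog_szemeredi_gowers:
  fixes P :: "('g::boolean_group \<times> ('g \<times> 'c)) pmf"
  assumes fin: "finite (set_pmf P)"
  shows "(\<Sum>w\<in>set_pmf (map_pmf snd P). pmf (map_pmf snd P) w * log_doubling (cond_law P w))
    \<le> 2 * H P (\<lambda>x. (fst x, snd (snd x))) + 2 * H P (\<lambda>x. (fst x + fst (snd x), snd (snd x)))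
      - 3 * H P (\<lambda>x. snd (snd x)) - 3 * ent P + 2 * H P snd"
proof -
  let ?q = "map_pmf snd P" and ?J = "cond_copies P"
  note fJ = finite_cond_copies[OF fin]
  let ?a = "\<lambda>x. fst (fst x)" and ?b = "\<lambda>x. snd (fst x)" and ?t = "\<lambda>x. fst (snd x)" and ?c = "\<lambda>x. snd (snd x)"
  have J: "ent ?J = 2 * ent P - H P snd"
    using ent_bind_tag[of ?q "\<lambda>w. pair_pmf (cond_law P w) (cond_law P w)"] finite_cond_law[OF fin] ent_cond_law[OF fin] fin
    by (simp add: cond_copies_def ent_pair_pmf ent_map sum_distrib_left algebra_simps)
  have "H ?J (\<lambda>x. (?a x + ?b x, snd x)) = ent ?q + (\<Sum>w\<in>set_pmf ?q. pmf ?q w * ent (conv (cond_law P w) (cond_law P w)))"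
    using H_bind_tag[of ?q "\<lambda>w. pair_pmf (cond_law P w) (cond_law P w)" "\<lambda>v. fst v + snd v"] finite_cond_law[OF fin] fin
    by (simp add: cond_copies_def H_def conv_def)
  then have D: "(\<Sum>w\<in>set_pmf ?q. pmf ?q w * log_doubling (cond_law P w)) = H ?J (\<lambda>x. (?a x + ?b x, snd x)) - ent P"
    using ent_cond_law[OF fin] by (simp add: log_doubling_def right_diff_distrib sum_subtractf ent_map)
  \<comment> \<open>The value a + b + t is read in two ways, as a + (b + t) and as (a + t) + b.
    Together with c, the sums a, a + t and a + b + t determine everything; submodularity leaves two
    pairs, which facts 5 and 6 split by subadditivity given c.\<close>
  have 1: "H ?J (\<lambda>x. (?a x, ?a x + ?t x, ?a x + ?b x + ?t x, ?c x)) + H ?J (\<lambda>x. (?a x + ?b x + ?t x, ?c x))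
     \<le> H ?J (\<lambda>x. (?a x, ?a x + ?b x + ?t x, ?c x)) + H ?J (\<lambda>x. (?a x + ?t x, ?a x + ?b x + ?t x, ?c x))"
    by (rule H_submodular[OF fJ])
  have 2: "H ?J (\<lambda>x. (?a x, ?a x + ?t x, ?a x + ?b x + ?t x, ?c x)) = H ?J (\<lambda>x. x)"
    using fJ by (intro H_eqI[where h = "\<lambda>((a,b),(t,c)). (a,a+t,a+b+t,c)"
          and k = "\<lambda>(a,s,u,c). ((a,u+s),(a+s,c))"]) (auto simp: add_ac)
  have 3: "H ?J (\<lambda>x. (?a x, ?a x + ?b x + ?t x, ?c x)) = H ?J (\<lambda>x. (?a x, ?b x + ?t x, ?c x))"
    using fJ by (intro H_eqI[where h = "\<lambda>(a,b,c). (a,a+b,c)" and k = "\<lambda>(a,b,c). (a,a+b,c)"]) (auto simp: add_ac)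
  have 4: "H ?J (\<lambda>x. (?a x + ?t x, ?a x + ?b x + ?t x, ?c x)) = H ?J (\<lambda>x. (?a x + ?t x, ?b x, ?c x))"
    using fJ by (intro H_eqI[where h = "\<lambda>(a,b,c). (a,a+b,c)" and k = "\<lambda>(a,b,c). (a,a+b,c)"]) (auto simp: add_ac)
  have 5: "H ?J (\<lambda>x. (?a x, ?b x + ?t x, ?c x)) + H ?J ?c \<le> H ?J (\<lambda>x. (?a x, ?c x)) + H ?J (\<lambda>x. (?b x + ?t x, ?c x))"
    by (rule H_submodular[OF fJ])
  have 6: "H ?J (\<lambda>x. (?a x + ?t x, ?b x, ?c x)) + H ?J ?c \<le> H ?J (\<lambda>x. (?a x + ?t x, ?c x)) + H ?J (\<lambda>x. (?b x, ?c x))"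
    by (rule H_submodular[OF fJ])
  \<comment> \<open>Given t, the sums a + b + t and a + b carry the same information, so the bound
    for the former becomes a bound for the doubling.\<close>
  have 7: "H ?J (\<lambda>x. (?a x + ?b x + ?t x, ?t x, ?c x)) + H ?J ?c \<le> H ?J (\<lambda>x. (?a x + ?b x + ?t x, ?c x)) + H ?J (\<lambda>x. (?t x, ?c x))"
    by (rule H_submodular[OF fJ])
  have 8: "H ?J (\<lambda>x. (?a x + ?b x + ?t x, ?t x, ?c x)) = H ?J (\<lambda>x. (?a x + ?b x, snd x))"
    using fJ by (intro H_eqI[where h = "\<lambda>(a,t,c). (a+t,t,c)" and k = "\<lambda>(a,t,c). (a+t,t,c)"]) (auto simp: add_ac)
  have "H ?J ?c = H P (\<lambda>x. snd (snd x))" "H ?J (\<lambda>x. (?t x, ?c x)) = H P snd"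
    using H_cond_copies(1)[of P "\<lambda>x. snd (snd x)"] H_cond_copies(1)[of P snd] by simp_all
  moreover have "H ?J (\<lambda>x. (?a x, ?c x)) = H P (\<lambda>x. (fst x, snd (snd x)))"
    "H ?J (\<lambda>x. (?b x, ?c x)) = H P (\<lambda>x. (fst x, snd (snd x)))"
    "H ?J (\<lambda>x. (?a x + ?t x, ?c x)) = H P (\<lambda>x. (fst x + fst (snd x), snd (snd x)))"
    "H ?J (\<lambda>x. (?b x + ?t x, ?c x)) = H P (\<lambda>x. (fst x + fst (snd x), snd (snd x)))"
    using H_cond_copies[of P "\<lambda>x. (fst x, snd (snd x))"] H_cond_copies[of P "\<lambda>x. (fst x + fst (snd x), snd (snd x))"]
    by simp_all
  ultimately show ?thesis
    using 1 2 3 4 5 6 7 8 J D by simp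
qed

lemma exists_ge_average:
  assumes "finite (set_pmf q)" "(\<Sum>w\<in>set_pmf q. pmf q w * F w) \<ge> c"
  shows "\<exists>w\<in>set_pmf q. F w \<ge> c"
proof (rule ccontr)
  assume "\<not> ?thesis"
  then have "(\<Sum>w\<in>set_pmf q. pmf q w * F w) < (\<Sum>w\<in>set_pmf q. pmf q w * c)"
    using assms(1) set_pmf_not_empty
    by (intro sum_strict_mono mult_strict_left_mono) (auto simp: not_le pmf_positive)
  then show False
    using assms by (simp flip: sum_distrib_right)
qed

text \<open>The Balog-Szemeredi-Gowers bound is applied to Y1 + Y2 and Y2 + Y3, whose sum is Y1 +
  Y3, given the total and the labels. Each pair sum has the same joint entropy with these, so the
  average doubling is at most 3 times \<open>fib_info P\<close>. Gain, doubling and entropy all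
  average over the label value, and some value does at least as well as the average.\<close>

lemma endgame:
  fixes P :: "'g::boolean_group lvar"
  assumes r: "finite (set_pmf r)" and P: "finite (set_pmf P)" and A: "0 \<le> A" and lam: "0 \<le> lam"
  shows "\<exists>p. finite (set_pmf p) \<and>
    gain r p - A * log_doubling p - lam * ent p
      \<ge> cond_gain r (fib_lvar (sum_lvar P)) - fib_info P - 3 * A * fib_info P - lam * (cond_ent P + cond_doubling P)"
proof -
  let ?u = "\<lambda>w. y1 w + y2 w" and ?t = "\<lambda>w. y2 w + y3 w" and ?s = "\<lambda>w. (y1 w + y2 w + y3 w + y4 w, zz w)"
  note fQ = finite_set_quad[OF P]
  define R where "R = map_pmf (\<lambda>w. (?u w, ?t w, ?s w)) (quad P)"
  define q where "q = map_pmf snd R"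
  have fR: "finite (set_pmf R)" using P by (simp add: R_def)
  have R1: "ent R = diff_ent P"
    by (simp add: R_def ent_map diff_ent_def)
  have R2: "H R snd = 2 * sum_ent P"
    using H_quad_23[OF P] by (simp add: R_def)
  have R3: "H R (\<lambda>x. (fst x, snd (snd x))) = 2 * sum_ent P"
    using H_quad_12[OF P] by (simp add: R_def)
  have R4: "H R (\<lambda>x. snd (snd x)) = sum_ent4 P"
    by (simp add: R_def sum_ent4_def)
  have R5: "H R (\<lambda>x. (fst x + fst (snd x), snd (snd x))) = 2 * sum_ent P"
    using H_quad_13[OF P] by (simp add: R_def add_ac)
  have log_doubling: "(\<Sum>w\<in>set_pmf q. pmf q w * log_doubling (cond_law R w)) \<le> 3 * fib_info P"
    using balog_szemeredi_gowers[OF fR] R1 R2 R3 R4 R5 by (simp add: fib_info_def q_def)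
  have ent: "(\<Sum>w\<in>set_pmf q. pmf q w * ent (cond_law R w)) = diff_ent P - 2 * sum_ent P"
    using ent_cond_law[OF fR] R1 R2 by (simp add: q_def)
  \<comment> \<open>Dropping Y2 + Y3 and the total from the conditions bounds the average entropy of
    the pieces by that of Y1 + Y2 given the four labels.\<close>
  have "H (quad P) (\<lambda>w. (?u w, (?t w, y1 w + y2 w + y3 w + y4 w), zz w)) + H (quad P) zz
      \<le> H (quad P) (\<lambda>w. (?u w, zz w)) + H (quad P) (\<lambda>w. ((?t w, y1 w + y2 w + y3 w + y4 w), zz w))"
    by (rule H_submodular[OF fQ])
  moreover have "H (quad P) (\<lambda>w. (?u w, (?t w, y1 w + y2 w + y3 w + y4 w), zz w)) = diff_ent P"
    unfolding diff_ent_def using P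
    by (intro H_eqI[where h = "\<lambda>(u,t,s,z). (u,(t,s),z)" and k = "\<lambda>(u,(t,s),z). (u,t,s,z)"]) auto
  moreover have "H (quad P) (\<lambda>w. ((?t w, y1 w + y2 w + y3 w + y4 w), zz w)) = 2 * sum_ent P"
    unfolding H_quad_23[OF P, symmetric] using P
    by (intro H_eqI[where h = "\<lambda>(t,s,z). ((t,s),z)" and k = "\<lambda>((t,s),z). (t,s,z)"]) auto
  moreover have "H (quad P) (\<lambda>w. (?u w, zz w)) = sum_ent P + 2 * H P snd"
  proof -
    have "H (quad P) (\<lambda>w. (?u w, zz w)) = H (quad P) (\<lambda>w. ((\<lambda>v. (fst (fst v) + fst (snd v), snd (fst v), snd (snd v))) (fst w),
       (\<lambda>v. (snd (fst v), snd (snd v))) (snd w)))"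
      using P by (intro H_eqI[where h = "\<lambda>((a,b,c),(d,e)). (a,b,c,d,e)" and k = "\<lambda>(a,b,c,d,e). ((a,b,c),(d,e))"]) auto
    also have "\<dots> = sum_ent P + 2 * H P snd"
      unfolding quad_def sum_ent_def using P H_two_labels[OF P] by (subst H_pair_indep) auto
    finally show ?thesis .
  qed
  moreover have "H (quad P) zz = 4 * H P snd"
  proof -
    have "H (quad P) zz = H (quad P) (\<lambda>w. ((\<lambda>v. (snd (fst v), snd (snd v))) (fst w), (\<lambda>v. (snd (fst v), snd (snd v))) (snd w)))"
      using P by (intro H_eqI[where h = "\<lambda>((b,c),(d,e)). (b,c,d,e)" and k = "\<lambda>(b,c,d,e). ((b,c),(d,e))"]) auto
    also have "\<dots> = 4 * H P snd"
      unfolding quad_def using P H_two_labels[OF P] by (subst H_pair_indep) auto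
    finally show ?thesis .
  qed
  ultimately have ent': "diff_ent P - 2 * sum_ent P \<le> cond_ent P + cond_doubling P"
    by (simp add: cond_doubling_def)
  let ?N = "pair_pmf r (quad P)"
  have fN: "finite (set_pmf ?N)" using r P by simp
  \<comment> \<open>Y1 + Y2 labelled by the total is equivalent to
    \<open>fib_lvar (sum_lvar P)\<close>; refining the label by Y2 + Y3 costs at most the
    conditional mutual information \<open>fib_info P\<close>.\<close>
  have "H ?N (\<lambda>v. (fst v + ?u (snd v), ?t (snd v), ?s (snd v))) + H ?N (\<lambda>v. ?s (snd v))
     \<le> H ?N (\<lambda>v. (fst v + ?u (snd v), ?s (snd v))) + H ?N (\<lambda>v. (?t (snd v), ?s (snd v)))"
    by (rule H_submodular[OF fN])
  moreover have "H ?N (\<lambda>v. ?s (snd v)) = sum_ent4 P"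
    unfolding sum_ent4_def by (rule H_pair_snd)
  moreover have "H ?N (\<lambda>v. (?t (snd v), ?s (snd v))) = 2 * sum_ent P"
    unfolding H_quad_23[OF P, symmetric] by (rule H_pair_snd)
  moreover have "cond_gain r R = ent r + diff_ent P - H ?N (\<lambda>v. (fst v + ?u (snd v), ?t (snd v), ?s (snd v)))"
    unfolding cond_gain_def R1 by (simp add: R_def H_pair_map_right)
  moreover have "cond_gain r (fib_lvar (sum_lvar P)) = ent r + 2 * sum_ent P - H ?N (\<lambda>v. (fst v + ?u (snd v), ?s (snd v)))"
  proof -
    have *: "fib_lvar (sum_lvar P) = map_pmf (\<lambda>w. (?u w, Node (?u w + (y3 w + y4 w))
       (Node 0 (snd (fst (fst w))) (snd (snd (fst w)))) (Node 0 (snd (fst (snd w))) (snd (snd (snd w)))))) (quad P)"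
      unfolding fib_lvar_def sum_lvar_def pair_map_map_pmf quad_def by (simp add: map_pmf_comp)
    have "ent (fib_lvar (sum_lvar P)) = 2 * sum_ent P"
      unfolding * ent_map H_quad_12[OF P, symmetric] using P
      by (intro H_eqI[where h = "\<lambda>(u,s,a,b,c,d). (u, Node s (Node 0 a b) (Node 0 c d))"
            and k = "\<lambda>(u,l). (u, val l, left (left l), right (left l), left (right l), right (right l))"]) (auto simp: add_ac)
    moreover have "H (pair_pmf r (fib_lvar (sum_lvar P))) (\<lambda>w. (fst w + fst (snd w), snd (snd w)))
       = H ?N (\<lambda>v. (fst v + ?u (snd v), ?s (snd v)))"
      unfolding * H_pair_map_right using fN
      by (intro H_eqI[where h = "\<lambda>(u,s,a,b,c,d). (u, Node s (Node 0 a b) (Node 0 c d))"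
            and k = "\<lambda>(u,l). (u, val l, left (left l), right (left l), left (right l), right (right l))"]) (auto simp: add_ac)
    ultimately show ?thesis by (simp add: cond_gain_def)
  qed
  ultimately have cond_gain: "cond_gain r R \<ge> cond_gain r (fib_lvar (sum_lvar P)) - fib_info P"
    by (simp add: fib_info_def)
  have "(\<Sum>w\<in>set_pmf q. pmf q w * (gain r (cond_law R w) - A * log_doubling (cond_law R w) - lam * ent (cond_law R w)))
     = cond_gain r R - A * (\<Sum>w\<in>set_pmf q. pmf q w * log_doubling (cond_law R w)) - lam * (diff_ent P - 2 * sum_ent P)"
    unfolding cond_gain_cond_law[OF r fR] ent[symmetric] q_def[symmetric]
    by (simp add: right_diff_distrib sum_subtractf sum_distrib_left mult.left_commute)
  also have "\<dots> \<ge> cond_gain r (fib_lvar (sum_lvar P)) - fib_info P - A * (3 * fib_info P) - lam * (cond_ent P + cond_doubling P)"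
    using cond_gain mult_left_mono[OF log_doubling A] mult_left_mono[OF ent' lam] by linarith
  finally have "\<exists>w\<in>set_pmf q. gain r (cond_law R w) - A * log_doubling (cond_law R w) - lam * ent (cond_law R w)
      \<ge> cond_gain r (fib_lvar (sum_lvar P)) - fib_info P - A * (3 * fib_info P) - lam * (cond_ent P + cond_doubling P)"
    by (intro exists_ge_average) (auto simp: q_def fR)
  then obtain w where "w \<in> set_pmf q"
    "gain r (cond_law R w) - A * log_doubling (cond_law R w) - lam * ent (cond_law R w)
      \<ge> cond_gain r (fib_lvar (sum_lvar P)) - fib_info P - A * (3 * fib_info P) - lam * (cond_ent P + cond_doubling P)"
    by blast
  moreover have "finite (set_pmf (cond_law R w))"
    using finite_cond_law[OF fR] \<open>w \<in> set_pmf q\<close> by (simp add: q_def)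
  ultimately show ?thesis by (intro exI[of _ "cond_law R w"]) (simp add: mult_ac)
qed

section \<open>Variables of small doubling\<close>

definition plain :: "'g pmf \<Rightarrow> 'g lvar"
  where "plain p = map_pmf (\<lambda>y. (y, Leaf)) p"

lemma finite_set_plain [simp]: "finite (set_pmf p) \<Longrightarrow> finite (set_pmf (plain p))"
  by (simp add: plain_def)

lemma fst_plain [simp]: "map_pmf fst (plain p) = p"
  by (simp add: plain_def map_pmf_comp)

lemma H_const [simp]: "H p (\<lambda>_. c) = 0"
  by (simp add: H_def ent_def)

lemma cond_ent_plain:
  assumes "finite (set_pmf p)"
  shows "cond_ent (plain p) = ent p"
proof -
  have "H p (\<lambda>y. (y, Leaf)) = H p (\<lambda>y. y)"
    using assms by (intro H_eqI[where h = "\<lambda>y. (y, Leaf)" and k = fst]) auto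
  then show ?thesis by (simp add: cond_ent_def plain_def ent_map)
qed

lemma cond_doubling_plain:
  fixes p :: "'g::boolean_group pmf"
  assumes "finite (set_pmf p)"
  shows "cond_doubling (plain p) = log_doubling p"
proof -
  have "sum_ent (plain p) = H (pair_pmf p p) (\<lambda>w. (fst w + snd w, Leaf :: 'g label, Leaf :: 'g label))"
    by (simp add: sum_ent_def plain_def pair_map_map_pmf)
  also have "\<dots> = H (pair_pmf p p) (\<lambda>w. fst w + snd w)"
    using assms by (intro H_eqI[where h = "\<lambda>y. (y, Leaf, Leaf)" and k = fst]) auto
  finally have "sum_ent (plain p) = ent (conv p p)"
    by (simp add: conv_def ent_map)
  moreover have "H (plain p) snd = 0" by (simp add: plain_def)
  ultimately show ?thesis using cond_ent_plain[OF assms] by (simp add: cond_doubling_def log_doubling_def)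
qed

lemma cond_gain_plain:
  fixes p :: "'g::boolean_group pmf"
  assumes "finite (set_pmf r)" "finite (set_pmf p)"
  shows "cond_gain r (plain p) = gain r p"
proof -
  have "H (pair_pmf r (plain p)) (\<lambda>w. (fst w + fst (snd w), snd (snd w))) = H (pair_pmf r p) (\<lambda>w. (fst w + snd w, Leaf :: 'g label))"
    by (simp add: plain_def H_pair_map_right)
  also have "\<dots> = H (pair_pmf r p) (\<lambda>w. fst w + snd w)"
    using assms by (intro H_eqI[where h = "\<lambda>y. (y, Leaf)" and k = fst]) auto
  finally have "H (pair_pmf r (plain p)) (\<lambda>w. (fst w + fst (snd w), snd (snd w))) = ent (conv r p)"
    by (simp add: conv_def ent_map)
  then show ?thesis
    using cond_ent_plain[OF assms(2)] by (simp add: cond_gain_def gain_def cond_ent_def plain_def)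
qed

lemma log_doubling_nonneg: "finite (set_pmf p) \<Longrightarrow> 0 \<le> log_doubling p"
  using cond_doubling_nonneg[of "plain p"] cond_doubling_plain[of p] by simp

text \<open>The factor \<open>20\<close> has to outweigh the total loss, a multiple of the doubling, of one fibre step
  followed by the endgame.\<close>

definition score :: "'g::boolean_group pmf \<Rightarrow> real \<Rightarrow> 'g lvar \<Rightarrow> real"
  where "score r lam P = cond_gain r P - 20 * cond_doubling P - lam * cond_ent P"

text \<open>Since neither the sum nor the fibre beats \<open>P\<close> by more than \<xi>, fibring
  makes \<open>fib_info P\<close> at most a tenth of the doubling, up to \<xi> / 10. The endgame
  then raises the score by at least 10 times the doubling minus 7 \<xi>. As it cannot rise by more
  than \<xi>, the doubling is small.\<close>

lemma near_maximiser_step: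
  fixes P :: "'g::boolean_group lvar"
  assumes r: "finite (set_pmf r)" and P: "finite (set_pmf P)" and lam: "0 \<le> lam" "lam \<le> 1"
    and max: "\<And>P'. finite (set_pmf P') \<Longrightarrow> score r lam P' \<le> score r lam P + \<xi>"
  shows "cond_doubling P \<le> \<xi> \<and> (\<exists>p. finite (set_pmf p) \<and> score r lam (plain p) \<ge> score r lam P - 7 * \<xi>)"
proof -
  note S = finite_set_sum_lvar[OF P]
  have d: "0 \<le> cond_doubling P" and m: "0 \<le> fib_info P" and df: "0 \<le> cond_doubling (fib_lvar P)"
    using P by (simp_all add: cond_doubling_nonneg fib_info_nonneg)
  have ld: "lam * cond_doubling P \<le> cond_doubling P" "0 \<le> lam * cond_doubling P"
    using d lam by (simp_all add: mult_left_le_one_le)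
  have \<xi>: "0 \<le> \<xi>" using max[OF P] by simp
  have 1: "20 * (cond_doubling P - cond_doubling (sum_lvar P)) \<le> cond_doubling P + \<xi>"
    using max[OF S] cond_gain_sum[OF r P] cond_ent_sum[OF P] ld by (simp add: score_def distrib_left)
  have 2: "20 * (cond_doubling P - cond_doubling (fib_lvar P)) \<le> cond_doubling P + \<xi>"
    using max[OF finite_set_fib_lvar[OF P]] cond_gain_fib[OF r P] cond_ent_fib[OF P] ld by (simp add: score_def right_diff_distrib)
  have 3: "20 * fib_info P \<le> 2 * cond_doubling P + 2 * \<xi>"
    using 1 2 fibring[OF P] by simp
  have 4: "cond_doubling (sum_lvar P) \<le> 2 * cond_doubling P" using fibring[OF P] m df by simp
  obtain p where p: "finite (set_pmf p)"
    and "gain r p - 20 * log_doubling p - lam * ent p \<ge> cond_gain r (fib_lvar (sum_lvar P)) - fib_info P - 60 * fib_info P - lam * (cond_ent P + cond_doubling P)"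
    using endgame[OF r P _ lam(1), of 20] by auto
  then have "score r lam (plain p) \<ge> cond_gain r (fib_lvar (sum_lvar P)) - 61 * fib_info P - lam * cond_ent P - lam * cond_doubling P"
    using p r by (simp add: score_def cond_gain_plain cond_ent_plain cond_doubling_plain distrib_left)
  moreover have "cond_gain r (fib_lvar (sum_lvar P)) \<ge> cond_gain r P - 2 * cond_doubling P"
    using cond_gain_fib[OF r S] cond_gain_sum[OF r P] 4 by simp
  \<comment> \<open>Of the 20 doublings in the score of \<open>P\<close>, 2 pay for the gain, 61/10
    for \<open>fib_info\<close> and 1 for the entropy term; at least 10 remain.\<close>
  ultimately have 5: "score r lam (plain p) \<ge> score r lam P + 10 * cond_doubling P - 7 * \<xi>"
    using 3 ld d \<xi> unfolding score_def by linarith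
  moreover have "score r lam (plain p) \<le> score r lam P + \<xi>" using max p by simp
  ultimately show ?thesis using p d \<xi> by (intro conjI exI[of _ p]) linarith+
qed

lemma score_le:
  assumes "finite (set_pmf r)" "finite (set_pmf P)" "0 \<le> lam"
  shows "score r lam P \<le> ent r"
  using cond_gain_le[OF assms(1,2)] cond_doubling_nonneg[OF assms(2)] mult_nonneg_nonneg[OF assms(3) cond_ent_nonneg[OF assms(2)]]
  by (simp add: score_def)

text \<open>The supremum need not be attained, and near-maximisers carry labels. One use of the step
  trades such a variable for an unlabelled near-maximiser; a second use, applied to the latter,
  bounds its doubling.\<close>

lemma exists_near_maximiser:
  fixes r :: "'g::boolean_group pmf"
  assumes r: "finite (set_pmf r)" and p0: "finite (set_pmf p0)" and lam: "0 \<le> lam" "lam \<le> 1" and \<xi>: "0 < \<xi>"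
  shows "\<exists>p. finite (set_pmf p) \<and> log_doubling p \<le> \<xi> \<and>
    gain r p - 20 * log_doubling p - lam * ent p \<ge> gain r p0 - 20 * log_doubling p0 - lam * ent p0 - \<xi>"
proof -
  define S where "S = score r lam ` {P. finite (set_pmf P)}"
  have bdd: "bdd_above S" unfolding S_def using score_le[OF r _ lam(1)] by (intro bdd_aboveI2) auto
  have mem: "score r lam P \<in> S" if "finite (set_pmf P)" for P using that by (auto simp: S_def)
  have ub: "score r lam P \<le> Sup S" if "finite (set_pmf P)" for P
    using cSup_upper[OF mem[OF that] bdd] .
  \<comment> \<open>The first use of the step loses 7/8 \<xi>, so a start within \<xi> / 8 of the
    supremum ends within \<xi> of it.\<close>
  have "\<exists>s\<in>S. Sup S - \<xi> / 8 < s"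
    using mem[of "plain p0"] p0 \<xi> by (intro less_cSupD) auto
  then obtain P where P: "finite (set_pmf P)" "score r lam P > Sup S - \<xi> / 8"
    by (auto simp: S_def)
  have "score r lam P' \<le> score r lam P + \<xi> / 8" if "finite (set_pmf P')" for P'
    using ub[OF that] P(2) by linarith
  from near_maximiser_step[OF r P(1) lam this]
  obtain p where p: "finite (set_pmf p)" "score r lam (plain p) \<ge> score r lam P - 7 * (\<xi> / 8)" by blast
  then have s: "score r lam (plain p) \<ge> Sup S - \<xi>" using P(2) by linarith
  have "score r lam P' \<le> score r lam (plain p) + \<xi>" if "finite (set_pmf P')" for P'
    using ub[OF that] s by linarith
  from near_maximiser_step[OF r finite_set_plain[OF p(1)] lam this]
  have "log_doubling p \<le> \<xi>" using p by (simp add: cond_doubling_plain)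
  moreover have "score r lam (plain p) \<ge> score r lam (plain p0) - \<xi>"
    using s ub[of "plain p0"] p0 by simp
  ultimately show ?thesis
    using p p0 r by (intro exI[of _ p]) (simp add: score_def cond_gain_plain cond_ent_plain cond_doubling_plain)
qed

section \<open>Descent to a variable with nearly tight fibring\<close>

text \<open>The law of a sum of 2^j independent copies, indexed so that one \<open>sum_lvar\<close>
  step advances j by 1.\<close>

fun conv_pow :: "'g::boolean_group pmf \<Rightarrow> nat \<Rightarrow> 'g pmf"
  where "conv_pow X 0 = X" | "conv_pow X (Suc j) = conv (conv_pow X j) (conv_pow X j)"

lemma finite_set_conv_pow [simp]: "finite (set_pmf X) \<Longrightarrow> finite (set_pmf (conv_pow X j))"
  by (induction j) auto

text \<open>No listed successor lowers the ratio of doubling to entropy by more than \<kappa>. The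
  inequality is multiplied out because \<open>cond_ent P'\<close> may vanish. The twofold sum is
  listed so that fibring can also be exploited for \<open>sum_lvar P\<close>.\<close>

definition stuck :: "real \<Rightarrow> 'g::boolean_group lvar \<Rightarrow> bool"
  where "stuck \<kappa> P \<longleftrightarrow> (\<forall>P'\<in>{sum_lvar P, fib_lvar P, sum_lvar (sum_lvar P)}.
    cond_doubling P' \<ge> (cond_doubling P / cond_ent P - \<kappa>) * cond_ent P')"

text \<open>Each move from a variable that is not stuck lowers the ratio by more than \<kappa>,
  which limits the number of moves. A fibre keeps the law of the variable and at least the fraction
  \<epsilon> of its entropy, because the ratio is at most 1 - \<epsilon>; sums do not lower the
  entropy and advance the convolution index by at most 2 per move.\<close>

lemma descend_to_stuck:
  fixes P :: "'g::boolean_group lvar"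
  assumes "0 < \<kappa>" "0 < \<epsilon>" "\<epsilon> \<le> 1" "finite (set_pmf P)" "map_pmf fst P = conv_pow X j"
    "0 < cond_ent P" "cond_doubling P \<le> (1 - \<epsilon>) * cond_ent P" "cond_doubling P \<le> real N * \<kappa> * cond_ent P"
  shows "\<exists>P' j'. finite (set_pmf P') \<and> map_pmf fst P' = conv_pow X j' \<and> j' \<le> j + 2 * N \<and>
    \<epsilon> ^ N * cond_ent P \<le> cond_ent P' \<and> cond_doubling P' \<le> (1 - \<epsilon>) * cond_ent P' \<and> stuck \<kappa> P'"
  using assms(4-)
proof (induction N arbitrary: P j)
  case 0
  \<comment> \<open>At ratio 0 the lower bounds demanded by \<open>stuck\<close> are
    nonpositive.\<close>
  have "cond_doubling P = 0" using 0 cond_doubling_nonneg[of P] by simp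
  moreover have "cond_ent P' \<ge> 0 \<and> cond_doubling P' \<ge> 0" if "P' \<in> {sum_lvar P, fib_lvar P, sum_lvar (sum_lvar P)}" for P'
    using that 0(1) by (auto simp: cond_ent_nonneg cond_doubling_nonneg)
  ultimately have "stuck \<kappa> P"
    using assms(1) unfolding stuck_def by (auto intro: order_trans[of _ 0] simp: mult_nonneg_nonneg)
  then show ?case using 0 by (intro exI[of _ P] exI[of _ j]) auto
next
  case (Suc N)
  define \<rho> where "\<rho> = cond_doubling P / cond_ent P"
  have d: "cond_doubling P = \<rho> * cond_ent P" using Suc.prems by (simp add: \<rho>_def)
  have \<rho>: "\<rho> \<le> 1 - \<epsilon>" "\<rho> \<le> (real N + 1) * \<kappa>"
    using Suc.prems by (simp_all add: d add_ac)
  show ?case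
  proof (cases "stuck \<kappa> P")
    case True
    have "\<epsilon> ^ Suc N * cond_ent P \<le> 1 * cond_ent P"
      using Suc.prems assms by (intro mult_right_mono power_le_one) auto
    then show ?thesis using True Suc.prems by (intro exI[of _ P] exI[of _ j]) auto
  next
    case False
    then obtain P' where P': "P' \<in> {sum_lvar P, fib_lvar P, sum_lvar (sum_lvar P)}" "cond_doubling P' < (\<rho> - \<kappa>) * cond_ent P'"
      by (auto simp: stuck_def \<rho>_def not_le)
    have f: "finite (set_pmf P')" using P'(1) Suc.prems by auto
    obtain i where i: "map_pmf fst P' = conv_pow X i" "i \<le> j + 2"
    proof -
      have "map_pmf fst P' \<in> {conv_pow X (Suc j), conv_pow X j, conv_pow X (Suc (Suc j))}"
        using P'(1) Suc.prems(2) by (auto simp: fst_sum_lvar fst_fib_lvar)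
      then show ?thesis using that[of "Suc j"] that[of j] that[of "Suc (Suc j)"] by auto
    qed
    have e: "\<epsilon> * cond_ent P \<le> cond_ent P'"
    proof -
      have "\<epsilon> * cond_ent P \<le> cond_ent P" using Suc.prems assms by (simp add: mult_left_le_one_le)
      moreover have "\<epsilon> * cond_ent P \<le> cond_ent (fib_lvar P)"
        using Suc.prems cond_ent_fib[of P] by (simp add: left_diff_distrib)
      moreover have "cond_ent P \<le> cond_ent (sum_lvar P)" "cond_ent (sum_lvar P) \<le> cond_ent (sum_lvar (sum_lvar P))"
        using Suc.prems by (simp_all add: cond_ent_sum cond_doubling_nonneg)
      ultimately show ?thesis using P'(1) by auto
    qed
    have c: "0 < cond_ent P'" using e mult_pos_pos[OF assms(2) Suc.prems(3)] by linarith
    have "\<rho> - \<kappa> \<le> 1 - \<epsilon>" "\<rho> - \<kappa> \<le> real N * \<kappa>"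
      using \<rho> assms(1) by (auto simp: algebra_simps)
    then have "(\<rho> - \<kappa>) * cond_ent P' \<le> (1 - \<epsilon>) * cond_ent P'" "(\<rho> - \<kappa>) * cond_ent P' \<le> real N * \<kappa> * cond_ent P'"
      using c by (auto intro!: mult_right_mono simp del: mult_le_cancel_right)
    then have "cond_doubling P' \<le> (1 - \<epsilon>) * cond_ent P'" "cond_doubling P' \<le> real N * \<kappa> * cond_ent P'"
      using P'(2) by linarith+
    from Suc.IH[OF f i(1) c this]
    obtain P'' j'' where *: "finite (set_pmf P'')" "map_pmf fst P'' = conv_pow X j''" "j'' \<le> i + 2 * N"
      "\<epsilon> ^ N * cond_ent P' \<le> cond_ent P''" "cond_doubling P'' \<le> (1 - \<epsilon>) * cond_ent P''" "stuck \<kappa> P''" by blast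
    have "\<epsilon> ^ Suc N * cond_ent P \<le> \<epsilon> ^ N * cond_ent P'"
      using mult_left_mono[OF e, of "\<epsilon> ^ N"] assms by (simp add: mult_ac)
    then show ?thesis using * i by (intro exI[of _ P''] exI[of _ j'']) auto
  qed
qed

text \<open>Fibring for \<open>P\<close> turns the lower bounds for sum and fibre into the bound on
  \<open>fib_info P\<close> and into an upper bound for the doubling \<open>x\<close> of the sum.
  Fibring for \<open>sum_lvar P\<close> then controls the fibre of the sum; the second claim is the
  estimate that \<open>cond_gain_self\<close> calls for.\<close>

lemma stuck_consequences:
  fixes P :: "'g::boolean_group lvar"
  assumes P: "finite (set_pmf P)" and c: "0 < cond_ent P" and d: "cond_doubling P \<le> (1 - \<epsilon>) * cond_ent P"
    and \<kappa>: "0 < \<kappa>" "\<kappa> \<le> 1" and \<epsilon>: "0 < \<epsilon>" and st: "stuck \<kappa> P"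
  shows "fib_info P \<le> 2 * \<kappa> * cond_ent P"
    and "(\<epsilon>\<^sup>2 - 7 * \<kappa>) * cond_ent P \<le> cond_ent (fib_lvar (sum_lvar P)) - cond_doubling (fib_lvar (sum_lvar P))"
proof -
  define h where "h = cond_ent P"
  define \<rho> where "\<rho> = cond_doubling P / cond_ent P"
  define x where "x = cond_doubling (sum_lvar P)"
  note S = finite_set_sum_lvar[OF P]
  have dP: "cond_doubling P = \<rho> * h" using c by (simp add: \<rho>_def h_def)
  have \<rho>: "0 \<le> \<rho>" "\<rho> \<le> 1 - \<epsilon>"
    using c d cond_doubling_nonneg[OF P] by (simp_all add: \<rho>_def pos_divide_le_eq)
  have h: "h > 0" using c by (simp add: h_def)
  have a: "x \<ge> (\<rho> - \<kappa>) * (h + \<rho> * h)"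
    and b: "cond_doubling (fib_lvar P) \<ge> (\<rho> - \<kappa>) * (h - \<rho> * h)"
    and e: "cond_doubling (sum_lvar (sum_lvar P)) \<ge> (\<rho> - \<kappa>) * (h + \<rho> * h + x)"
    using st cond_ent_sum[OF P] cond_ent_fib[OF P] cond_ent_sum[OF S]
    using h by (auto simp: stuck_def x_def[symmetric] h_def[symmetric] dP)
  have "x + cond_doubling (fib_lvar P) + fib_info P = 2 * \<rho> * h"
    using fibring[OF P] by (simp add: x_def dP)
  with a b show "fib_info P \<le> 2 * \<kappa> * cond_ent P"
    unfolding h_def[symmetric] by (simp add: algebra_simps)
  have "x \<le> 2 * \<rho> * h - (\<rho> - \<kappa>) * (h - \<rho> * h)"
    using \<open>x + cond_doubling (fib_lvar P) + fib_info P = 2 * \<rho> * h\<close> fib_info_nonneg[OF P] b by linarith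
  also have "\<dots> = (\<rho> + \<rho>\<^sup>2 + \<kappa>) * h - \<kappa> * \<rho> * h" by (simp add: algebra_simps power2_eq_square)
  also have "\<dots> \<le> (\<rho> + \<rho>\<^sup>2 + \<kappa>) * h" using \<kappa> \<rho> h by simp
  finally have x: "x \<le> (\<rho> + \<rho>\<^sup>2 + \<kappa>) * h" .
  have "cond_doubling (fib_lvar (sum_lvar P)) \<le> 2 * x - (\<rho> - \<kappa>) * (h + \<rho> * h + x)"
    using fibring[OF S] fib_info_nonneg[OF S] e by (simp add: x_def)
  moreover have "cond_ent (fib_lvar (sum_lvar P)) = h + \<rho> * h - x"
    using cond_ent_fib[OF S] cond_ent_sum[OF P] by (simp add: x_def h_def dP[unfolded h_def])
  ultimately have "cond_ent (fib_lvar (sum_lvar P)) - cond_doubling (fib_lvar (sum_lvar P))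
     \<ge> (1 + \<rho>) * (1 + \<rho> - \<kappa>) * h - (3 - \<rho> + \<kappa>) * x"
    by (simp add: algebra_simps)
  moreover have "(3 - \<rho> + \<kappa>) * x \<le> (3 - \<rho> + \<kappa>) * ((\<rho> + \<rho>\<^sup>2 + \<kappa>) * h)"
    using x \<rho> \<kappa> \<epsilon> by (intro mult_left_mono) auto
  moreover have "(\<epsilon>\<^sup>2 - 7 * \<kappa>) * h \<le> ((1 + \<rho>) * (1 + \<rho> - \<kappa>) - (3 - \<rho> + \<kappa>) * (\<rho> + \<rho>\<^sup>2 + \<kappa>)) * h"
  proof (rule mult_right_mono)
    have \<rho>2: "\<rho>\<^sup>2 \<le> 1" "\<rho> \<le> 1" using \<rho> \<epsilon> by (auto simp: power_le_one)
    \<comment> \<open>The part free of \<kappa> factors as (1 + \<rho>) (1 - \<rho>)^2 with 1 -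
      \<rho> \<ge> \<epsilon>, and 7 bounds the cofactor of \<kappa>.\<close>
    have "(1 + \<rho>) * (1 + \<rho> - \<kappa>) - (3 - \<rho> + \<kappa>) * (\<rho> + \<rho>\<^sup>2 + \<kappa>)
      = (1 + \<rho>) * (1 - \<rho>)\<^sup>2 - \<kappa> * (4 + \<rho> + \<rho>\<^sup>2 + \<kappa>)"
      by (simp add: algebra_simps power2_eq_square)
    moreover have "\<kappa> * (4 + \<rho> + \<rho>\<^sup>2 + \<kappa>) \<le> \<kappa> * 7"
      using \<kappa> \<rho>2 by (intro mult_left_mono) auto
    moreover have "\<epsilon>\<^sup>2 \<le> (1 - \<rho>)\<^sup>2" using \<rho> \<epsilon> by (intro power_mono) auto
    moreover have "(1 - \<rho>)\<^sup>2 \<le> (1 + \<rho>) * (1 - \<rho>)\<^sup>2" using \<rho> by (simp add: mult_le_cancel_right1)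
    ultimately show "\<epsilon>\<^sup>2 - 7 * \<kappa> \<le> (1 + \<rho>) * (1 + \<rho> - \<kappa>) - (3 - \<rho> + \<kappa>) * (\<rho> + \<rho>\<^sup>2 + \<kappa>)"
      by linarith
  qed (use h in simp)
  ultimately show "(\<epsilon>\<^sup>2 - 7 * \<kappa>) * cond_ent P \<le> cond_ent (fib_lvar (sum_lvar P)) - cond_doubling (fib_lvar (sum_lvar P))"
    unfolding h_def[symmetric] by (simp add: algebra_simps)
qed

text \<open>Descent from \<open>X\<close> gives a stuck \<open>P\<close>. As reference variable R
  serves the law of the fibre of its sum with the label forgotten, so \<open>cond_gain_self\<close>
  applies; this law is \<open>conv_pow X (Suc j)\<close>, whence the bound 2 N + 1.\<close>

lemma exists_structured:
  fixes X :: "'g::boolean_group pmf"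
  assumes X: "finite (set_pmf X)" and \<epsilon>: "0 < \<epsilon>" "\<epsilon> \<le> 1" and M: "0 < M" "ent X \<le> M"
    and doubling: "ent (conv X X) \<le> 2 * ent X - \<epsilon> * M"
    and N: "1000 / \<epsilon>\<^sup>2 \<le> real N"
  shows "\<exists>j p. j \<le> 2 * N + 1 \<and> finite (set_pmf p) \<and>
    gain (conv_pow X j) p - 20 * log_doubling p - \<epsilon>\<^sup>2 / 8 * ent p \<ge> \<epsilon> ^ (N + 3) / 2 * M"
proof -
  define \<kappa> where "\<kappa> = \<epsilon>\<^sup>2 / 1000"
  have \<epsilon>2: "0 < \<epsilon>\<^sup>2" "\<epsilon>\<^sup>2 \<le> 1" using \<epsilon> by (auto simp: power_le_one)
  have \<kappa>: "0 < \<kappa>" "\<kappa> \<le> 1" using \<epsilon>2 by (auto simp: \<kappa>_def)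
  have hX: "\<epsilon> * M \<le> ent X" using log_doubling_nonneg[OF X] doubling by (simp add: log_doubling_def)
  have c: "0 < cond_ent (plain X)" using hX mult_pos_pos[OF \<epsilon>(1) M(1)] X by (simp add: cond_ent_plain)
  have dX: "cond_doubling (plain X) \<le> (1 - \<epsilon>) * cond_ent (plain X)"
  proof -
    have "\<epsilon> * ent X \<le> \<epsilon> * M" using M \<epsilon> by (intro mult_left_mono) auto
    then have "log_doubling X \<le> ent X - \<epsilon> * ent X" using doubling unfolding log_doubling_def by linarith
    then show ?thesis using X by (simp add: cond_ent_plain cond_doubling_plain left_diff_distrib)
  qed
  have "1 \<le> real N * \<kappa>" using N \<epsilon>2 by (simp add: \<kappa>_def field_simps)
  then have "cond_ent (plain X) \<le> real N * \<kappa> * cond_ent (plain X)" using c by (simp add: mult_le_cancel_right1)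
  moreover have "cond_doubling (plain X) \<le> cond_ent (plain X)"
    using dX mult_pos_pos[OF \<epsilon>(1) c] by (simp add: algebra_simps)
  ultimately have "cond_doubling (plain X) \<le> real N * \<kappa> * cond_ent (plain X)" by linarith
  from descend_to_stuck[OF \<kappa>(1) \<epsilon> finite_set_plain[OF X] _ c dX this, of X 0]
  obtain P j where P: "finite (set_pmf P)" "map_pmf fst P = conv_pow X j" "j \<le> 2 * N"
    "\<epsilon> ^ N * ent X \<le> cond_ent P" "cond_doubling P \<le> (1 - \<epsilon>) * cond_ent P" "stuck \<kappa> P"
    using X by (auto simp: cond_ent_plain)
  define h where "h = cond_ent P"
  have "\<epsilon> ^ N * (\<epsilon> * M) \<le> \<epsilon> ^ N * ent X" using hX \<epsilon> by (intro mult_left_mono) auto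
  then have h: "\<epsilon> ^ (N + 1) * M \<le> h" using P(4) by (simp add: h_def mult_ac)
  moreover have "0 < \<epsilon> ^ (N + 1) * M" using \<epsilon> M by simp
  ultimately have h0: "0 < h" by linarith
  note sc = stuck_consequences[OF P(1) h0[unfolded h_def] P(5) \<kappa> \<epsilon>(1) P(6), folded h_def]
  define r where "r = conv_pow X (Suc j)"
  have r: "r = map_pmf fst (fib_lvar (sum_lvar P))"
    by (simp add: r_def fst_fib_lvar fst_sum_lvar P(2))
  have fr: "finite (set_pmf r)" using X by (simp add: r_def del: conv_pow.simps)
  have "cond_gain r (fib_lvar (sum_lvar P)) \<ge> (\<epsilon>\<^sup>2 - 7 * \<kappa>) * h"
    using cond_gain_self[of "fib_lvar (sum_lvar P)"] sc(2) P(1) by (simp flip: r)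
  moreover obtain p where p: "finite (set_pmf p)"
    "gain r p - 20 * log_doubling p - \<epsilon>\<^sup>2 / 8 * ent p \<ge> cond_gain r (fib_lvar (sum_lvar P)) - fib_info P - 60 * fib_info P - \<epsilon>\<^sup>2 / 8 * (h + cond_doubling P)"
    using endgame[OF fr P(1), of 20 "\<epsilon>\<^sup>2 / 8"] \<epsilon>2 by (auto simp: h_def)
  moreover have "cond_doubling P \<le> h" using P(5) mult_pos_pos[OF \<epsilon>(1) h0] by (simp add: h_def algebra_simps)
  then have "\<epsilon>\<^sup>2 / 8 * (h + cond_doubling P) \<le> \<epsilon>\<^sup>2 / 8 * (2 * h)" using \<epsilon>2 by (intro mult_left_mono) auto
  \<comment> \<open>In units of \<epsilon>^2 h the gain is 0.993, the 61 copies of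
    \<open>fib_info\<close> cost at most 0.122 and the entropy term at most 0.25, so more than 1/2
    is left.\<close>
  moreover have "(\<epsilon>\<^sup>2 - 7 * \<kappa>) * h = \<epsilon>\<^sup>2 * h * (993 / 1000)" "2 * \<kappa> * h = \<epsilon>\<^sup>2 * h * (2 / 1000)"
    by (simp_all add: \<kappa>_def algebra_simps)
  moreover have "\<epsilon>\<^sup>2 / 8 * (2 * h) = \<epsilon>\<^sup>2 * h * (1 / 4)" by simp
  moreover have "0 < \<epsilon>\<^sup>2 * h" using \<epsilon>2 h0 by simp
  ultimately have "gain r p - 20 * log_doubling p - \<epsilon>\<^sup>2 / 8 * ent p \<ge> \<epsilon>\<^sup>2 * h / 2"
    using sc(1) by linarith
  moreover have "\<epsilon> ^ (N + 3) / 2 * M \<le> \<epsilon>\<^sup>2 * h / 2"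
  proof -
    have "\<epsilon>\<^sup>2 * (\<epsilon> ^ (N + 1) * M) \<le> \<epsilon>\<^sup>2 * h" using h \<epsilon>2 by (intro mult_left_mono) auto
    then show ?thesis by (simp add: power_add power2_eq_square power3_eq_cube mult_ac)
  qed
  ultimately show ?thesis
    using p P(3) unfolding r_def by (intro exI[of _ "Suc j"] exI[of _ p]) auto
qed

section \<open>From small doubling to subspaces\<close>

text \<open>Closure under negation is automatic, since every element is its own inverse.\<close>

definition is_subgroup :: "'g::boolean_group set \<Rightarrow> bool"
  where "is_subgroup V \<longleftrightarrow> 0 \<in> V \<and> (\<forall>x\<in>V. \<forall>y\<in>V. x + y \<in> V)"

lemma neg_pmf_ln_nonneg: "0 \<le> - pmf p x * ln (pmf p x)"
proof (cases "pmf p x = 0")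
  case False
  then have "0 < pmf p x" by (simp add: less_le)
  then show ?thesis by (simp add: mult_nonneg_nonpos pmf_le_1)
qed simp

text \<open>Adjoining one generator \<open>s\<close> at most doubles the group. The result serves as
  a finite domain on which sums can be translated, and later as the span of a small set.\<close>

lemma finite_subset_subgroup:
  fixes S :: "'g::boolean_group set"
  assumes "finite S"
  shows "\<exists>F. finite F \<and> card F \<le> 2 ^ card S \<and> is_subgroup F \<and> S \<subseteq> F"
  using assms
proof induction
  case empty
  show ?case by (rule exI[of _ "{0}"]) (simp add: is_subgroup_def)
next
  case (insert s S)
  then obtain F where F: "finite F" "card F \<le> 2 ^ card S" "is_subgroup F" "S \<subseteq> F" by blast
  have "x + y \<in> F \<union> (+) s ` F" if "x \<in> F \<union> (+) s ` F" "y \<in> F \<union> (+) s ` F" for x y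
    using that F(3) by (auto simp: is_subgroup_def add_ac image_iff)
  moreover have "s \<in> (+) s ` F" using F(3) by (force simp: is_subgroup_def)
  moreover have "card (F \<union> (+) s ` F) \<le> 2 ^ card (insert s S)"
    using card_Un_le[of F "(+) s ` F"] card_image_le[OF F(1), of "(+) s"] F(2) insert.hyps by simp
  ultimately show ?case
    using F by (intro exI[of _ "F \<union> (+) s ` F"]) (auto simp: is_subgroup_def)
qed

lemma sum_translate:
  assumes "is_subgroup F" "h \<in> F"
  shows "(\<Sum>x\<in>F. f (x + h)) = sum f F"
  by (rule sum.reindex_bij_witness[of _ "\<lambda>x. x + h" "\<lambda>x. x + h"]) (use assms in \<open>auto simp: is_subgroup_def add.assoc\<close>)

lemma sum_pmf_superset: "finite F \<Longrightarrow> set_pmf p \<subseteq> F \<Longrightarrow> (\<Sum>x\<in>F. pmf p x) = 1"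
  by (rule sum_pmf_eq_1)

lemma ent_superset:
  assumes "finite F" "set_pmf p \<subseteq> F"
  shows "ent p = (\<Sum>x\<in>F. - pmf p x * ln (pmf p x))"
  unfolding ent_def using assms by (intro sum.mono_neutral_left) (auto simp: set_pmf_iff)

lemma pmf_conv:
  assumes F: "finite F" "is_subgroup F" and p: "set_pmf p \<subseteq> F" and x: "x \<in> F"
  shows "pmf (conv p q) x = (\<Sum>y\<in>F. pmf p y * pmf q (x + y))"
proof -
  have e: "y + z = x \<longleftrightarrow> z = x + y" for y z :: 'a
    by (metis add.commute add_self_left)
  have "conv p q = bind_pmf p (\<lambda>y. map_pmf (\<lambda>z. y + z) q)"
    unfolding conv_def pair_pmf_def map_bind_pmf map_return_pmf fst_conv snd_conv by (simp add: map_pmf_def)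
  then have "pmf (conv p q) x = (\<Sum>y\<in>F. pmf (map_pmf (\<lambda>z. y + z) q) x * pmf p y)"
    using F p by (simp add: pmf_bind) (rule integral_measure_pmf_real, auto)
  also have "\<dots> = (\<Sum>y\<in>F. pmf p y * pmf q (x + y))"
  proof (intro sum.cong refl)
    fix y
    have "pmf (map_pmf (\<lambda>z. y + z) q) (y + (x + y)) = pmf q (x + y)"
      by (rule pmf_map_inj') (auto simp: inj_def)
    then show "pmf (map_pmf (\<lambda>z. y + z) q) x * pmf p y = pmf p y * pmf q (x + y)"
      by (simp add: add.left_commute)
  qed
  finally show ?thesis .
qed

lemma set_conv_subset:
  assumes "is_subgroup F" "set_pmf p \<subseteq> F" "set_pmf q \<subseteq> F"
  shows "set_pmf (conv p q) \<subseteq> F"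
  using assms by (fastforce simp: conv_def is_subgroup_def)

text \<open>Pointwise, ln u \<le> u - 1 for the ratio u of the square roots of b and a gives 2 a - 2
  sqrt(a b) \<le> a ln(a / b). As both masses are 1, the left sides add up to the squared Hellinger
  distance.\<close>

lemma hellinger_le_relative_entropy:
  fixes a b :: "'a \<Rightarrow> real"
  assumes a: "\<And>x. x \<in> F \<Longrightarrow> 0 \<le> a x" and b: "\<And>x. x \<in> F \<Longrightarrow> 0 \<le> b x"
    and ab: "\<And>x. x \<in> F \<Longrightarrow> 0 < a x \<Longrightarrow> 0 < b x" and "sum a F = 1" "sum b F = 1"
  shows "(\<Sum>x\<in>F. (sqrt (a x) - sqrt (b x))\<^sup>2) \<le> (\<Sum>x\<in>F. a x * (ln (a x) - ln (b x)))"
proof -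
  have "2 * a x - 2 * (sqrt (a x) * sqrt (b x)) \<le> a x * (ln (a x) - ln (b x))" if x: "x \<in> F" for x
  proof (cases "a x = 0")
    case False
    then have p: "0 < a x" "0 < b x" using a[OF x] ab[OF x] by auto
    define s t where "s = sqrt (a x)" and "t = sqrt (b x)"
    have st: "0 < s" "0 < t" "a x = s * s" "b x = t * t" using p by (auto simp: s_def t_def)
    have "ln (t / s) \<le> t / s - 1" using st by (intro ln_le_minus_one) auto
    then have "s * s * (2 * (1 - t / s)) \<le> s * s * (2 * (ln s - ln t))"
      using st by (intro mult_left_mono) (auto simp: ln_div)
    moreover have "s * s * (2 * (1 - t / s)) = 2 * (s * s) - 2 * (s * t)" using st by (simp add: field_simps)
    moreover have "s * s * (2 * (ln s - ln t)) = s * s * (ln (s * s) - ln (t * t))" using st by (simp add: ln_mult)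
    ultimately show ?thesis
      unfolding s_def[symmetric] t_def[symmetric] st(3,4)[symmetric] by linarith
  qed simp
  then have "(\<Sum>x\<in>F. 2 * a x - 2 * (sqrt (a x) * sqrt (b x))) \<le> (\<Sum>x\<in>F. a x * (ln (a x) - ln (b x)))"
    by (intro sum_mono) auto
  moreover have "(\<Sum>x\<in>F. (sqrt (a x) - sqrt (b x))\<^sup>2) = (\<Sum>x\<in>F. a x + b x - 2 * (sqrt (a x) * sqrt (b x)))"
    using a b by (intro sum.cong refl) (simp add: power2_diff)
  ultimately show ?thesis
    using assms(4,5) by (simp add: sum.distrib sum_subtractf sum_distrib_left[symmetric])
qed

text \<open>The doubling is a mean relative entropy: for y drawn from \<open>p\<close>, the
  translate of \<open>p\<close> by y is compared with \<open>conv p p\<close>.\<close>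

lemma log_doubling_expansion:
  assumes F: "finite F" "is_subgroup F" and p: "set_pmf p \<subseteq> F"
  shows "log_doubling p = (\<Sum>y\<in>F. pmf p y * (\<Sum>x\<in>F. pmf p (x + y) * (ln (pmf p (x + y)) - ln (pmf (conv p p) x))))"
proof -
  have q: "set_pmf (conv p p) \<subseteq> F" by (rule set_conv_subset[OF F(2) p p])
  have "ent (conv p p) = (\<Sum>x\<in>F. \<Sum>y\<in>F. pmf p y * (pmf p (x + y) * - ln (pmf (conv p p) x)))"
    unfolding ent_superset[OF F(1) q]
    by (intro sum.cong refl) (simp add: pmf_conv[OF F p] sum_distrib_right sum_negf mult.assoc)
  also have "\<dots> = (\<Sum>y\<in>F. pmf p y * (\<Sum>x\<in>F. pmf p (x + y) * - ln (pmf (conv p p) x)))"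
    by (subst sum.swap) (simp add: sum_distrib_left)
  finally have 1: "ent (conv p p) = (\<Sum>y\<in>F. pmf p y * (\<Sum>x\<in>F. pmf p (x + y) * - ln (pmf (conv p p) x)))" .
  have "(\<Sum>y\<in>F. pmf p y * (\<Sum>x\<in>F. - pmf p (x + y) * ln (pmf p (x + y)))) = (\<Sum>y\<in>F. pmf p y * ent p)"
    using sum_translate[OF F(2), of _ "\<lambda>x. - pmf p x * ln (pmf p x)"]
    by (intro sum.cong refl) (simp add: ent_superset[OF F(1) p])
  also have "\<dots> = ent p" using sum_pmf_superset[OF F(1) p] by (simp flip: sum_distrib_right)
  finally have 2: "ent p = (\<Sum>y\<in>F. pmf p y * (\<Sum>x\<in>F. - pmf p (x + y) * ln (pmf p (x + y))))" by simp
  show ?thesis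
    unfolding log_doubling_def 1 2
    by (simp add: right_diff_distrib sum_subtractf sum_negf)
qed

text \<open>Most translates of \<open>p\<close> are Hellinger-close to \<open>conv p p\<close>,
  hence to each other. \<open>V\<close> consists of the shifts that move \<open>p\<close> little,
  and a gap makes it a subgroup: a sum of two such shifts has \<open>N\<close> at most 1, every
  shift with that bound is a sum of two elements of \<open>G\<close>, and those have
  \<open>N\<close> at most 1/4.\<close>

lemma small_doubling_subgroup:
  fixes p :: "'g::boolean_group pmf"
  assumes fin: "finite (set_pmf p)" and log_doubling: "log_doubling p \<le> 1 / 1000"
  shows "\<exists>V g. finite V \<and> is_subgroup V \<and> ln (real (card V)) \<le> 32 * ent p + 2 \<and>
    (\<Sum>x\<in>{x\<in>set_pmf p. x + g \<in> V}. pmf p x) \<ge> 98 / 100"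
proof -
  obtain F where F: "finite F" "is_subgroup F" and p: "set_pmf p \<subseteq> F"
    using finite_subset_subgroup[OF fin] by blast
  have Fadd: "x + y \<in> F" if "x \<in> F" "y \<in> F" for x y using F(2) that by (auto simp: is_subgroup_def)
  define q where "q = conv p p"
  have q: "set_pmf q \<subseteq> F" unfolding q_def by (rule set_conv_subset[OF F(2) p p])
  have p1: "(\<Sum>x\<in>F. pmf p x) = 1" and q1: "(\<Sum>x\<in>F. pmf q x) = 1"
    using F p q by (simp_all add: sum_pmf_superset)
  have pt: "(\<Sum>x\<in>F. pmf p (x + y)) = 1" if "y \<in> F" for y
    using sum_translate[OF F(2) that, of "pmf p"] p1 by simp
  define s where "s = (\<lambda>x. sqrt (pmf p x))"
  have s0: "0 \<le> s x" and s2: "(s x)\<^sup>2 = pmf p x" for x by (simp_all add: s_def)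
  define hd where "hd = (\<lambda>y. \<Sum>x\<in>F. (s (x + y) - sqrt (pmf q x))\<^sup>2)"
  have hd0: "0 \<le> hd y" for y by (simp add: hd_def sum_nonneg)
  have "pmf p y * hd y \<le> pmf p y * (\<Sum>x\<in>F. pmf p (x + y) * (ln (pmf p (x + y)) - ln (pmf q x)))" if y: "y \<in> F" for y
  proof (cases "pmf p y = 0")
    case False
    have "hd y \<le> (\<Sum>x\<in>F. pmf p (x + y) * (ln (pmf p (x + y)) - ln (pmf q x)))"
      unfolding hd_def s_def
    proof (rule hellinger_le_relative_entropy)
      fix x assume x: "x \<in> F" and pos: "0 < pmf p (x + y)"
      have "0 < pmf p y * pmf p (x + y)" using False pos by (simp add: less_le)
      also have "\<dots> \<le> pmf q x"
        unfolding q_def pmf_conv[OF F p x] using y F by (intro member_le_sum) auto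
      finally show "0 < pmf q x" .
    qed (use pt[OF y] q1 in auto)
    then show ?thesis by (intro mult_left_mono) auto
  qed simp
  then have "(\<Sum>y\<in>F. pmf p y * hd y) \<le> log_doubling p"
    unfolding log_doubling_expansion[OF F p] q_def[symmetric] by (intro sum_mono) auto
  then have avg: "(\<Sum>y\<in>F. pmf p y * hd y) \<le> 1 / 1000" using log_doubling by simp
  define G where "G = {y\<in>F. hd y \<le> 1 / 16}"
  have G: "G \<subseteq> F" by (auto simp: G_def)
  \<comment> \<open>Markov's inequality; 16/1000 is below both the 1/16 required by
    \<open>pop\<close> and the 2/100 allowed in the conclusion.\<close>
  have massG: "(\<Sum>y\<in>F - G. pmf p y) \<le> 16 / 1000"
  proof -
    have "(\<Sum>y\<in>F - G. pmf p y * (1 / 16)) \<le> (\<Sum>y\<in>F - G. pmf p y * hd y)"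
      by (intro sum_mono mult_left_mono) (auto simp: G_def)
    also have "\<dots> \<le> (\<Sum>y\<in>F. pmf p y * hd y)"
      using F hd0 by (intro sum_mono2) auto
    finally show ?thesis using avg by (simp flip: sum_divide_distrib)
  qed
  define N where "N = (\<lambda>h. \<Sum>x\<in>F. (s (x + h) - s x)\<^sup>2)"
  have sq: "(a - c)\<^sup>2 \<le> 2 * (a - b)\<^sup>2 + 2 * (b - c)\<^sup>2" for a b c :: real
    using zero_le_power2[of "a - 2 * b + c"] by (simp add: power2_eq_square algebra_simps)
  have NG: "N (y + y') \<le> 1 / 4" if "y \<in> G" "y' \<in> G" for y y'
  proof -
    have y: "y \<in> F" "y' \<in> F" "hd y \<le> 1 / 16" "hd y' \<le> 1 / 16" using that by (auto simp: G_def)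
    have "N (y + y') = (\<Sum>x\<in>F. (s (x + y) - s (x + y'))\<^sup>2)"
      using sum_translate[OF F(2) y(2), of "\<lambda>x. (s (x + y) - s (x + y'))\<^sup>2"] by (simp add: N_def add_ac)
    also have "\<dots> \<le> (\<Sum>x\<in>F. 2 * (s (x + y) - sqrt (pmf q x))\<^sup>2 + 2 * (sqrt (pmf q x) - s (x + y'))\<^sup>2)"
      by (intro sum_mono sq)
    also have "\<dots> = 2 * hd y + 2 * hd y'"
      by (simp add: hd_def sum.distrib sum_distrib_left power2_commute)
    finally show ?thesis using y by simp
  qed
  define V where "V = {h\<in>F. N h \<le> 1 / 4}"
  have Nadd: "N (h + h') \<le> 2 * N h + 2 * N h'" if "h' \<in> F" for h h'
  proof -
    have "N (h + h') \<le> (\<Sum>x\<in>F. 2 * (s (x + (h + h')) - s (x + h'))\<^sup>2 + 2 * (s (x + h') - s x)\<^sup>2)"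
      unfolding N_def by (intro sum_mono sq)
    also have "\<dots> = 2 * N h + 2 * N h'"
      using sum_translate[OF F(2) that, of "\<lambda>x. (s (x + h) - s x)\<^sup>2"]
      by (simp add: N_def sum.distrib sum_distrib_left[symmetric] add_ac)
    finally show ?thesis .
  qed
  \<comment> \<open>The bound on \<open>N h\<close> says that the affinity of \<open>p\<close> and
    its shift is at least 1/2. If y and y + h were never both in \<open>S\<close>, every term would
    involve the complement of \<open>S\<close>, and 2 a b \<le> 4 a^2 + b^2 / 4 would keep the total
    below 4/16 + 1/4.\<close>
  have pop: "\<exists>y\<in>S. y + h \<in> S" if h: "h \<in> F" "N h \<le> 1" and S: "S \<subseteq> F" "(\<Sum>y\<in>F - S. pmf p y) < 1 / 16" for h S
  proof (rule ccontr)
    assume no: "\<not> ?thesis"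
    have "(\<Sum>x\<in>F. (s (x + h) - s x)\<^sup>2) = (\<Sum>x\<in>F. pmf p (x + h) + pmf p x - 2 * (s (x + h) * s x))"
      by (simp add: power2_diff s2 mult.assoc)
    then have "N h = 2 - 2 * (\<Sum>x\<in>F. s (x + h) * s x)"
      using pt[OF h(1)] p1 by (simp add: N_def sum.distrib sum_subtractf sum_distrib_left[symmetric])
    then have "1 / 2 \<le> (\<Sum>x\<in>F. s (x + h) * s x)" using h by simp
    also have "\<dots> \<le> (\<Sum>x\<in>F. (if x \<in> F - S then s (x + h) * s x else 0) + (if x + h \<in> F - S then s (x + h) * s x else 0))"
      using no s0 Fadd h by (intro sum_mono) auto
    also have "\<dots> = (\<Sum>x\<in>F - S. s (x + h) * s x) + (\<Sum>x\<in>F. if x + h \<in> F - S then s (x + h) * s (x + h + h) else 0)"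
      using F S by (simp add: sum.distrib add.assoc sum.inter_restrict[symmetric] Int_absorb1 flip: sum.inter_filter)
        (simp add: set_diff_eq)
    also have "(\<Sum>x\<in>F. if x + h \<in> F - S then s (x + h) * s (x + h + h) else 0) = (\<Sum>x\<in>F. if x \<in> F - S then s x * s (x + h) else 0)"
      by (rule sum_translate[OF F(2) h(1)])
    also have "\<dots> = (\<Sum>x\<in>F - S. s (x + h) * s x)"
      using F by (simp add: mult.commute flip: sum.inter_filter) (simp add: set_diff_eq)
    finally have "1 / 2 \<le> (\<Sum>x\<in>F - S. 2 * (s (x + h) * s x))" by (simp add: sum_distrib_left[symmetric])
    also have "\<dots> \<le> (\<Sum>x\<in>F - S. 4 * pmf p x + pmf p (x + h) / 4)"
    proof (intro sum_mono)
      fix x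
      have "0 \<le> (2 * s x - s (x + h) / 2)\<^sup>2" by simp
      then show "2 * (s (x + h) * s x) \<le> 4 * pmf p x + pmf p (x + h) / 4"
        by (simp add: power2_diff power_mult_distrib power_divide s2 mult_ac)
    qed
    also have "\<dots> \<le> 4 * (\<Sum>x\<in>F - S. pmf p x) + (\<Sum>x\<in>F. pmf p (x + h)) / 4"
      using F by (auto simp: sum.distrib sum_distrib_left sum_divide_distrib intro!: sum_mono2)
    finally show False using S(2) pt[OF h(1)] by simp
  qed
  have sub: "is_subgroup V"
    unfolding is_subgroup_def
  proof (intro conjI ballI)
    show "0 \<in> V" using F(2) by (simp add: V_def N_def is_subgroup_def)
    fix h h' assume h: "h \<in> V" "h' \<in> V"
    then have F': "h \<in> F" "h' \<in> F" "h + h' \<in> F" using Fadd by (auto simp: V_def)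
    have "N (h + h') \<le> 1" using Nadd[OF F'(2), of h] h by (simp add: V_def)
    with pop[OF F'(3) _ G] massG obtain y where "y \<in> G" "y + (h + h') \<in> G" by auto
    from NG[OF this] show "h + h' \<in> V" using F' by (simp add: V_def)
  qed
  have finV: "finite V" using F by (simp add: V_def)
  have "G \<noteq> {}" using massG p1 by auto
  then obtain g where g: "g \<in> G" by blast
  have mass: "(\<Sum>x\<in>{x\<in>set_pmf p. x + g \<in> V}. pmf p x) \<ge> 98 / 100"
  proof -
    have "1 - 16 / 1000 \<le> (\<Sum>x\<in>G. pmf p x)"
      using massG p1 sum.subset_diff[OF G F(1), of "pmf p"] by simp
    also have "\<dots> = (\<Sum>x\<in>G \<inter> set_pmf p. pmf p x)"
      using F G by (intro sum.mono_neutral_right) (auto simp: set_pmf_iff intro: finite_subset)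
    also have "\<dots> \<le> (\<Sum>x\<in>{x\<in>set_pmf p. x + g \<in> V}. pmf p x)"
      using fin NG[OF _ g] subsetD[OF G] g Fadd by (intro sum_mono2) (auto simp: V_def)
    finally show ?thesis by simp
  qed
  \<comment> \<open>By Markov's inequality for the surprisal, atoms lighter than \<open>t\<close>
    have mass below 1/16; the summand 1 keeps this strict when the entropy is 0. Then
    \<open>pop\<close> puts \<open>V\<close> inside \<open>B + B\<close>, and \<open>B\<close> has
    at most 1 / \<open>t\<close> elements.\<close>
  define t where "t = exp (- (16 * ent p + 1))"
  define B where "B = {y\<in>F. t \<le> pmf p y}"
  have massB: "(\<Sum>y\<in>F - B. pmf p y) < 1 / 16"
  proof -
    have "(\<Sum>y\<in>F - B. pmf p y * (16 * ent p + 1)) \<le> (\<Sum>y\<in>F - B. - pmf p y * ln (pmf p y))"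
    proof (intro sum_mono)
      fix y assume y: "y \<in> F - B"
      show "pmf p y * (16 * ent p + 1) \<le> - pmf p y * ln (pmf p y)"
      proof (cases "pmf p y = 0")
        case False
        then have "0 < pmf p y" by (simp add: less_le)
        moreover have "pmf p y < t" using y by (auto simp: B_def)
        ultimately have "ln (pmf p y) < ln t" by simp
        then have "16 * ent p + 1 \<le> - ln (pmf p y)" by (simp add: t_def)
        then show ?thesis using mult_left_mono[of "16 * ent p + 1" "- ln (pmf p y)" "pmf p y"] by simp
      qed simp
    qed
    also have "\<dots> \<le> ent p"
      unfolding ent_superset[OF F(1) p] using F
      by (intro sum_mono2 neg_pmf_ln_nonneg) auto
    finally have "(\<Sum>y\<in>F - B. pmf p y) * (16 * ent p + 1) \<le> ent p" by (simp flip: sum_distrib_right)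
    moreover have "0 < 16 * ent p + 1" using ent_nonneg[of p] by linarith
    ultimately have "(\<Sum>y\<in>F - B. pmf p y) \<le> ent p / (16 * ent p + 1)"
      by (simp add: pos_le_divide_eq)
    also have "\<dots> < 1 / 16" using \<open>0 < 16 * ent p + 1\<close> by (simp add: pos_divide_less_eq)
    finally show ?thesis .
  qed
  have B: "finite B" "B \<subseteq> F" using F by (auto simp: B_def)
  have "V \<subseteq> (\<lambda>(x,y). x + y) ` (B \<times> B)"
  proof
    fix h assume h: "h \<in> V"
    then obtain y where "y \<in> B" "y + h \<in> B" using pop[OF _ _ B(2) massB, of h] by (auto simp: V_def)
    then show "h \<in> (\<lambda>(x,y). x + y) ` (B \<times> B)" by (intro image_eqI[of _ _ "(y, y + h)"]) auto
  qed
  then have "card V \<le> card (B \<times> B)"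
    using B by (meson card_image_le card_mono finite_SigmaI finite_imageI order_trans)
  then have cV: "real (card V) \<le> real (card B) * real (card B)" by (simp add: card_cartesian_product flip: of_nat_mult)
  have "real (card B) * t = (\<Sum>y\<in>B. t)" by simp
  also have "\<dots> \<le> (\<Sum>y\<in>B. pmf p y)" by (intro sum_mono) (auto simp: B_def)
  also have "\<dots> \<le> 1" unfolding p1[symmetric] using F B by (intro sum_mono2) auto
  finally have "real (card B) \<le> 1 / t"
    by (simp add: t_def pos_le_divide_eq)
  also have "\<dots> = exp (16 * ent p + 1)" unfolding t_def exp_minus by (simp only: divide_inverse inverse_inverse_eq mult_1_left)
  finally have "real (card B) \<le> exp (16 * ent p + 1)" .
  then have "real (card B) * real (card B) \<le> exp (16 * ent p + 1) * exp (16 * ent p + 1)"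
    by (intro mult_mono) auto
  with cV have "real (card V) \<le> exp (32 * ent p + 2)"
    by (simp flip: exp_add)
  moreover have "0 < real (card V)" using sub finV by (auto simp: is_subgroup_def card_gt_0_iff)
  ultimately have "ln (real (card V)) \<le> 32 * ent p + 2"
    by (metis ln_exp ln_le_cancel_iff exp_gt_zero)
  then show ?thesis using finV sub mass by blast
qed

section \<open>Homomorphisms\<close>

lemma conv_commute: "conv p q = conv q p"
  unfolding conv_def by (subst pair_commute_pmf) (simp add: map_pmf_comp case_prod_unfold add.commute)

lemma ent_conv_le:
  assumes "finite (set_pmf p)" "finite (set_pmf q)"
  shows "ent (conv p q) \<le> ent p + ent q"
  using H_comp_le[of "pair_pmf p q" "\<lambda>w. fst w + snd w" "\<lambda>w. w"] assms
  by (simp add: conv_def ent_map ent_pair_pmf)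

lemma ent_le_conv:
  assumes "finite (set_pmf r)" "finite (set_pmf p)"
  shows "ent r \<le> ent (conv r p)"
  using cond_gain_le[of p "plain r"] cond_gain_plain[of p r] assms by (simp add: gain_def conv_commute[of p r])

lemma ent_map_le: "finite (set_pmf p) \<Longrightarrow> ent (map_pmf f p) \<le> ent p"
  using H_comp_le[of p f "\<lambda>x. x"] by (simp add: ent_map)

definition add_hom :: "('g::boolean_group \<Rightarrow> 'h::boolean_group) \<Rightarrow> bool"
  where "add_hom f \<longleftrightarrow> (\<forall>x y. f (x + y) = f x + f y)"

lemma add_hom_0: "add_hom f \<Longrightarrow> f 0 = 0"
  by (metis add_hom_def add_self)

lemma map_conv: "add_hom f \<Longrightarrow> map_pmf f (conv p q) = conv (map_pmf f p) (map_pmf f q)"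
  by (simp add: conv_def pair_map_map_pmf map_pmf_comp add_hom_def)

lemma map_conv_pow: "add_hom f \<Longrightarrow> map_pmf f (conv_pow X j) = conv_pow (map_pmf f X) j"
  by (induction j) (simp_all add: map_conv)

lemma ent_conv_pow_le:
  assumes "finite (set_pmf X)"
  shows "ent (conv_pow X j) \<le> 2 ^ j * ent X"
proof (induction j)
  case (Suc j)
  then show ?case using ent_conv_le[of "conv_pow X j" "conv_pow X j"] assms by simp
qed simp

text \<open>For R and Y with laws \<open>r\<close> and \<open>p\<close>, the right side is the
  mutual information of R + Y and R, and the left side is that of their images. The two
  submodularity steps replace first R and then the sum by its image.\<close>

lemma conv_data_processing:
  assumes f: "add_hom f" and r: "finite (set_pmf r)" and p: "finite (set_pmf p)"
  shows "ent (conv (map_pmf f r) (map_pmf f p)) - ent (map_pmf f p) \<le> ent (conv r p) - ent p"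
proof -
  let ?Q = "pair_pmf r p"
  let ?s = "\<lambda>w. fst w + snd w"
  have fin: "finite (set_pmf ?Q)" using r p by simp
  have "H ?Q (\<lambda>w. (?s w, fst w, f (fst w))) + H ?Q (\<lambda>w. f (fst w)) \<le> H ?Q (\<lambda>w. (?s w, f (fst w))) + H ?Q (\<lambda>w. (fst w, f (fst w)))"
    by (rule H_submodular[OF fin])
  moreover have "H ?Q (\<lambda>w. (?s w, fst w, f (fst w))) = H ?Q (\<lambda>w. w)"
    using fin by (intro H_eqI[where h = "\<lambda>(a,b). (a+b,a,f a)" and k = "\<lambda>(s,a,c). (a,a+s)"]) auto
  moreover have "H ?Q (\<lambda>w. (fst w, f (fst w))) = H ?Q fst"
    using fin by (intro H_eqI[where h = "\<lambda>a. (a,f a)" and k = fst]) auto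
  moreover have "H ?Q (\<lambda>w. (?s w, f (fst w), f (?s w))) + H ?Q (\<lambda>w. f (?s w)) \<le> H ?Q (\<lambda>w. (?s w, f (?s w))) + H ?Q (\<lambda>w. (f (fst w), f (?s w)))"
    by (rule H_submodular[OF fin])
  moreover have "H ?Q (\<lambda>w. (?s w, f (fst w), f (?s w))) = H ?Q (\<lambda>w. (?s w, f (fst w)))"
    using fin by (intro H_eqI[where h = "\<lambda>(s,a). (s,a,f s)" and k = "\<lambda>(s,a,b). (s,a)"]) auto
  moreover have "H ?Q (\<lambda>w. (?s w, f (?s w))) = H ?Q ?s"
    using fin by (intro H_eqI[where h = "\<lambda>s. (s,f s)" and k = fst]) auto
  moreover have "H ?Q (\<lambda>w. (f (fst w), f (?s w))) = H ?Q (\<lambda>w. (f (fst w), f (snd w)))"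
    using fin f by (intro H_eqI[where h = "\<lambda>(a,b). (a,a+b)" and k = "\<lambda>(a,b). (a,a+b)"]) (auto simp: add_hom_def)
  moreover have "H ?Q (\<lambda>w. (f (fst w), f (snd w))) = H r f + H p f"
    by (rule H_pair_indep[OF r p])
  moreover have "H ?Q (\<lambda>w. f (fst w)) = H r f" by (rule H_pair_fst)
  moreover have "H ?Q fst = ent r" using H_pair_fst[of r p id] by simp
  moreover have "H ?Q (\<lambda>w. w) = ent r + ent p" using r p by (simp add: ent_pair_pmf)
  moreover have "ent (conv (map_pmf f r) (map_pmf f p)) = H ?Q (\<lambda>w. f (?s w))"
    unfolding map_conv[OF f, symmetric] by (simp add: conv_def ent_map)
  moreover have "ent (conv r p) = H ?Q ?s" by (simp add: conv_def ent_map)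
  ultimately show ?thesis by (simp add: ent_map)
qed

lemma neg_x_ln_mono:
  fixes a b :: real
  assumes "0 < a" "a \<le> b" "b \<le> exp (-1)"
  shows "- a * ln a \<le> - b * ln b"
proof -
  have "ln (b / a) \<le> b / a - 1" using assms by (intro ln_le_minus_one) auto
  then have "a * (ln b - ln a) \<le> a * (b / a - 1)" using assms by (intro mult_left_mono) (auto simp: ln_div)
  then have "- a * ln a \<le> (b - a) - a * ln b" using assms by (simp add: right_diff_distrib)
  moreover have "ln b \<le> -1" using assms by (metis ln_exp ln_le_cancel_iff exp_gt_zero less_le_trans)
  then have "(b - a) * 1 \<le> (b - a) * (- ln b)" using assms by (intro mult_left_mono) auto
  ultimately show ?thesis by (simp add: left_diff_distrib)
qed

text \<open>For x other than the heavy atom v, the pairs (v, x) and (x, v) give the convolution mass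
  at least 1.96 W(x) at x + v. So the entropy away from v nearly doubles under convolution, which
  small doubling permits only if it is tiny.\<close>

lemma ent_le_of_atom:
  fixes W :: "'g::boolean_group pmf"
  assumes fin: "finite (set_pmf W)" and log_doubling: "log_doubling W \<le> 1 / 1000" and atom: "pmf W v \<ge> 98 / 100"
  shows "ent W \<le> 1"
proof -
  obtain F where F: "finite F" "is_subgroup F" and W: "set_pmf W \<subseteq> F"
    using finite_subset_subgroup[OF fin] by blast
  define q where "q = conv W W"
  define S where "S = set_pmf W - {v}"
  have v: "v \<in> set_pmf W" "v \<in> F" using atom W by (auto simp: set_pmf_iff)
  have Fadd: "x + y \<in> F" if "x \<in> F" "y \<in> F" for x y using F(2) that by (auto simp: is_subgroup_def)
  have q: "set_pmf q \<subseteq> F" unfolding q_def by (rule set_conv_subset[OF F(2) W W])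
  have pq: "pmf q x = (\<Sum>y\<in>F. pmf W y * pmf W (x + y))" if "x \<in> F" for x
    unfolding q_def by (rule pmf_conv[OF F W that])
  have S: "finite S" "S \<subseteq> F" using fin W by (auto simp: S_def)
  have lower: "196 / 100 * pmf W x \<le> pmf q (x + v)" if x: "x \<in> S" for x
  proof -
    have "(\<Sum>y\<in>{v, x}. pmf W y * pmf W (x + v + y)) \<le> pmf q (x + v)"
      unfolding pq[OF Fadd[OF subsetD[OF S(2) x] v(2)]] using F v S x by (intro sum_mono2) auto
    moreover have "(\<Sum>y\<in>{v, x}. pmf W y * pmf W (x + v + y)) = 2 * pmf W v * pmf W x"
    proof -
      have e: "x + v + v = x" "x + v + x = v" by (simp_all add: add_ac)
      show ?thesis using x unfolding e by (auto simp: S_def e)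
    qed
    moreover have "196 / 100 * pmf W x \<le> 2 * pmf W v * pmf W x" using atom by (intro mult_right_mono) auto
    ultimately show ?thesis by linarith
  qed
  have q0: "pmf q 0 \<ge> 98 / 100 * (98 / 100)"
  proof -
    have "98 / 100 * (98 / 100) \<le> pmf W v * pmf W v" using atom by (intro mult_mono) auto
    also have "\<dots> = pmf W v * pmf W (0 + v)" by simp
    also have "\<dots> \<le> pmf q 0"
      using F v by (subst pq) (auto simp: is_subgroup_def intro!: member_le_sum[of v F "\<lambda>y. pmf W y * pmf W y"])
    finally show ?thesis .
  qed
  \<comment> \<open>This keeps the values in the range up to exp (-1), where - x ln x increases: the
    mass of \<open>q\<close> at 0 leaves less than 1/3 for other points.\<close>
  have upper: "pmf q (x + v) \<le> exp (-1)" if x: "x \<in> S" for x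
  proof -
    have ne: "x + v \<noteq> 0" using x by (metis DiffE S_def add.right_neutral add_self_left insertI1 add.commute)
    have "(\<Sum>y\<in>{0, x + v}. pmf q y) \<le> (\<Sum>y\<in>F. pmf q y)"
      using F v S x Fadd by (intro sum_mono2) (auto simp: is_subgroup_def)
    then have "pmf q (x + v) \<le> 1 - 98 / 100 * (98 / 100)"
      using ne q0 sum_pmf_superset[OF F(1) q] by simp
    also have "\<dots> \<le> 1 / 3" by simp
    also have "\<dots> \<le> exp (-1 :: real)" using exp_le by (simp add: exp_minus field_simps)
    finally show ?thesis .
  qed
  define E where "E = (\<Sum>x\<in>S. - pmf W x * ln (pmf W x))"
  have massS: "(\<Sum>x\<in>S. pmf W x) \<le> 2 / 100"
    using sum_pmf_set[OF fin] atom sum.remove[OF fin v(1), of "pmf W"] by (simp add: S_def)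
  have "196 / 100 * E - 196 / 100 * (\<Sum>x\<in>S. pmf W x) \<le> (\<Sum>x\<in>S. - pmf q (x + v) * ln (pmf q (x + v)))"
    unfolding E_def sum_distrib_left sum_subtractf[symmetric]
  proof (intro sum_mono)
    fix x assume x: "x \<in> S"
    then have p: "0 < pmf W x" by (auto simp: S_def pmf_positive)
    have "ln (196 / 100 :: real) \<le> 1" using ln_le_minus_one[of "196 / 100"] by simp
    then have "196 / 100 * pmf W x * ln (196 / 100) \<le> 196 / 100 * pmf W x * 1" using p by (intro mult_left_mono) auto
    then have "196 / 100 * (- pmf W x * ln (pmf W x)) - 196 / 100 * pmf W x \<le> - (196 / 100 * pmf W x) * (ln (196 / 100) + ln (pmf W x))"
      by (simp add: algebra_simps)
    also have "\<dots> = - (196 / 100 * pmf W x) * ln (196 / 100 * pmf W x)" using p by (subst ln_mult) auto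
    also have "\<dots> \<le> - pmf q (x + v) * ln (pmf q (x + v))"
      using p lower[OF x] upper[OF x] by (intro neg_x_ln_mono) auto
    finally show "196 / 100 * (- pmf W x * ln (pmf W x)) - 196 / 100 * pmf W x \<le> - pmf q (x + v) * ln (pmf q (x + v))" .
  qed
  also have "\<dots> = (\<Sum>y\<in>(\<lambda>x. x + v) ` S. - pmf q y * ln (pmf q y))"
    by (subst sum.reindex) (auto simp: inj_on_def)
  also have "\<dots> \<le> ent q"
    unfolding ent_superset[OF F(1) q]
  proof (rule sum_mono2)
    fix y
    show "0 \<le> - pmf q y * ln (pmf q y)" by (rule neg_pmf_ln_nonneg)
  qed (use F S v Fadd in auto)
  finally have 1: "196 / 100 * E - 196 / 100 * (2 / 100) \<le> ent q" using massS by simp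
  have "- pmf W v * ln (pmf W v) \<le> 2 / 100"
  proof -
    have "ln (1 / pmf W v) \<le> 1 / pmf W v - 1" using atom by (intro ln_le_minus_one) auto
    then have "pmf W v * - ln (pmf W v) \<le> pmf W v * (1 / pmf W v - 1)"
      using atom by (intro mult_left_mono) (auto simp: ln_div)
    then show ?thesis using atom by (simp add: right_diff_distrib)
  qed
  then have "ent W \<le> E + 2 / 100"
    unfolding ent_def E_def S_def using sum.remove[OF fin v(1), of "\<lambda>x. - pmf W x * ln (pmf W x)"] by simp
  moreover have "ent q \<le> ent W + 1 / 1000" using log_doubling by (simp add: log_doubling_def q_def)
  ultimately show ?thesis using 1 by linarith
qed

section \<open>Quotients realised by endomorphisms\<close>

instance bit :: boolean_group
  by standard simp

instance "fun" :: (type, boolean_group) boolean_group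
  by standard (simp add: fun_eq_iff)

text \<open>Taking the quotient inside the same type lets successive quotients be composed. If v in
  \<open>V\<close> has v i = 1, the map adding v exactly to the vectors with i-th coordinate 1 has
  kernel {0, v} and sends \<open>V\<close> to a smaller subgroup, where the induction
  applies.\<close>

lemma exists_hom_with_kernel:
  fixes V :: "(nat \<Rightarrow> bit) set"
  assumes "finite V" "is_subgroup V"
  shows "\<exists>f :: (nat \<Rightarrow> bit) \<Rightarrow> (nat \<Rightarrow> bit). add_hom f \<and> (\<forall>x. f x = 0 \<longleftrightarrow> x \<in> V)"
  using assms
proof (induction "card V" arbitrary: V rule: less_induct)
  case less
  show ?case
  proof (cases "V = {0}")
    case True
    then show ?thesis by (intro exI[of _ "\<lambda>x. x"]) (simp add: add_hom_def)
  next
    case False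
    then obtain v where v: "v \<in> V" "v \<noteq> 0" using less.prems by (auto simp: is_subgroup_def)
    then obtain i where "v i \<noteq> 0" by (auto simp: fun_eq_iff)
    then have i: "v i = 1" by (cases "v i") auto
    define t where "t = (\<lambda>x. if x i = (1::bit) then x + v else x)"
    have t: "add_hom t"
      unfolding add_hom_def
    proof (intro allI)
      fix x y
      show "t (x + y) = t x + t y"
        by (cases "x i"; cases "y i") (auto simp: t_def add_ac)
    qed
    have t0: "t x = 0 \<longleftrightarrow> x = 0 \<or> x = v" for x
    proof -
      have "x + v = 0 \<longleftrightarrow> x = v" by (metis add.commute add.right_neutral add_self_left add_self)
      then show ?thesis using i by (auto simp: t_def)
    qed
    have Vadd: "x + y \<in> V" if "x \<in> V" "y \<in> V" for x y using less.prems that by (auto simp: is_subgroup_def)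
    have V0: "0 \<in> V" using less.prems by (auto simp: is_subgroup_def)
    have sub: "is_subgroup (t ` V)"
      unfolding is_subgroup_def
    proof (intro conjI ballI)
      show "0 \<in> t ` V" using V0 add_hom_0[OF t] by (metis imageI)
      fix a b assume "a \<in> t ` V" "b \<in> t ` V"
      then show "a + b \<in> t ` V" using t Vadd by (auto simp: add_hom_def) (metis imageI)
    qed
    have "t v = t 0" using t0[of v] t0[of 0] by simp
    then have "\<not> inj_on t V" using v V0 by (auto dest: inj_onD)
    then have "card (t ` V) < card V"
      using less.prems(1) card_image_le[of V t] eq_card_imp_inj_on[of V t] by (auto simp: le_less)
    from less.hyps[OF this _ sub] less.prems(1)
    obtain f :: "(nat \<Rightarrow> bit) \<Rightarrow> (nat \<Rightarrow> bit)" where f: "add_hom f" "\<And>x. f x = 0 \<longleftrightarrow> x \<in> t ` V" by auto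
    have "t x \<in> t ` V \<longleftrightarrow> x \<in> V" for x
    proof
      assume "t x \<in> t ` V"
      then obtain y where y: "y \<in> V" "t x = t y" by auto
      then have "t (x + y) = 0" using t by (simp add: add_hom_def)
      then have "x + y \<in> V" using t0 v V0 by auto
      from Vadd[OF y(1) this] show "x \<in> V" by (simp add: add_ac)
    qed auto
    then show ?thesis
      using f t by (intro exI[of _ "\<lambda>x. f (t x)"]) (simp add: add_hom_def)
  qed
qed

section \<open>The entropy decrement\<close>

lemma pmf_map_hom:
  assumes f: "add_hom f" "\<And>x. f x = 0 \<longleftrightarrow> x \<in> V" and p: "finite (set_pmf p)"
  shows "pmf (map_pmf f p) (f g) = (\<Sum>x\<in>{x\<in>set_pmf p. x + g \<in> V}. pmf p x)"
proof -
  have "f x = f g \<longleftrightarrow> x + g \<in> V" for x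
  proof -
    have "f x = f g \<longleftrightarrow> f x + f g = 0" by (metis add.commute add.right_neutral add_self add_self_left)
    then show ?thesis using f(1) f(2)[of "x + g"] by (simp add: add_hom_def)
  qed
  then have "f -` {f g} \<inter> set_pmf p = {x\<in>set_pmf p. x + g \<in> V}" by auto
  moreover have "pmf (map_pmf f p) (f g) = measure p (f -` {f g} \<inter> set_pmf p)"
    by (simp add: pmf_map measure_Int_set_pmf)
  moreover have "\<dots> = sum (pmf p) (f -` {f g} \<inter> set_pmf p)"
    using p by (intro measure_measure_pmf_finite) auto
  ultimately show ?thesis by simp
qed

text \<open>A near-maximiser \<open>p\<close>, started from the variable of
  \<open>exists_structured\<close>, has small doubling and so lives mostly on one coset of a
  subgroup \<open>V\<close>. Modulo \<open>V\<close> its entropy is at most 1, while its gain is at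
  least 3 \<delta> M; adding it to R therefore forces the entropy of R down in the quotient.\<close>

lemma entropy_decrement:
  fixes X :: "(nat \<Rightarrow> bit) pmf"
  assumes X: "finite (set_pmf X)" and \<epsilon>: "0 < \<epsilon>" "\<epsilon> \<le> 1" and M: "ent X \<le> M" "1 \<le> \<delta> * M"
    and doubling: "ent (conv X X) \<le> 2 * ent X - \<epsilon> * M"
    and N: "1000 / \<epsilon>\<^sup>2 \<le> real N" and \<delta>: "\<delta> = \<epsilon> ^ (N + 3) / 8"
  shows "\<exists>j f V. j \<le> 2 * N + 1 \<and> add_hom (f :: (nat \<Rightarrow> bit) \<Rightarrow> (nat \<Rightarrow> bit)) \<and> finite V \<and>
    (\<forall>x. f x = 0 \<longleftrightarrow> x \<in> V) \<and> ln (real (card V)) \<le> (256 * 2 ^ (2 * N + 1) / \<epsilon>\<^sup>2 + 2) * M \<and>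
    ent (map_pmf f (conv_pow X j)) \<le> ent (conv_pow X j) - \<delta> * M"
proof -
  have \<epsilon>2: "0 < \<epsilon>\<^sup>2" "\<epsilon>\<^sup>2 \<le> 1" using \<epsilon> by (auto simp: power_le_one)
  have d: "0 < \<delta>" "\<delta> \<le> 1" using \<epsilon> power_le_one[of \<epsilon> "N + 3"] by (auto simp: \<delta>)
  have M0: "0 < M" using M(2) d by (smt (verit) mult_nonneg_nonpos)
  have "\<delta> * M \<le> 1 * M" using M0 d by (intro mult_right_mono) auto
  then have M1: "1 \<le> M" using M by linarith
  obtain j p0 where p0: "j \<le> 2 * N + 1" "finite (set_pmf p0)"
    "gain (conv_pow X j) p0 - 20 * log_doubling p0 - \<epsilon>\<^sup>2 / 8 * ent p0 \<ge> \<epsilon> ^ (N + 3) / 2 * M"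
    using exists_structured[OF X \<epsilon> M0 M(1) doubling N] by blast
  define r where "r = conv_pow X j"
  have r: "finite (set_pmf r)" using X by (simp add: r_def)
  obtain p where p: "finite (set_pmf p)" "log_doubling p \<le> 1 / 1000"
    "gain r p - 20 * log_doubling p - \<epsilon>\<^sup>2 / 8 * ent p \<ge> gain r p0 - 20 * log_doubling p0 - \<epsilon>\<^sup>2 / 8 * ent p0 - 1 / 1000"
    using exists_near_maximiser[OF r p0(2), of "\<epsilon>\<^sup>2 / 8" "1 / 1000"] \<epsilon>2 by auto
  \<comment> \<open>One of these four units absorbs the error 1/1000, since 1 \<le> \<delta>
    M.\<close>
  have "4 * (\<delta> * M) \<le> gain (conv_pow X j) p0 - 20 * log_doubling p0 - \<epsilon>\<^sup>2 / 8 * ent p0" using p0(3) by (simp add: \<delta> mult.commute)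
  then have low: "3 * (\<delta> * M) \<le> gain r p - \<epsilon>\<^sup>2 / 8 * ent p"
    using p(3) M(2) log_doubling_nonneg[OF p(1)] unfolding r_def by linarith
  have gmr: "gain r p \<le> ent r" using cond_gain_le[OF r finite_set_plain[OF p(1)]] cond_gain_plain[OF r p(1)] by simp
  \<comment> \<open>The entropy penalty in the score now pays off: it bounds \<open>ent p\<close>,
    and hence ln of the size of \<open>V\<close>, by a multiple of M.\<close>
  have "ent r \<le> 2 ^ j * ent X" unfolding r_def by (rule ent_conv_pow_le[OF X])
  also have "\<dots> \<le> 2 ^ (2 * N + 1) * M"
    using M p0(1) by (intro mult_mono power_increasing) auto
  finally have "\<epsilon>\<^sup>2 / 8 * ent p \<le> 2 ^ (2 * N + 1) * M" using low gmr M by linarith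
  then have entp: "ent p \<le> 8 * 2 ^ (2 * N + 1) / \<epsilon>\<^sup>2 * M"
    using \<epsilon>2 by (simp add: field_simps)
  obtain V g where V: "finite V" "is_subgroup V" "ln (real (card V)) \<le> 32 * ent p + 2"
    "(\<Sum>x\<in>{x\<in>set_pmf p. x + g \<in> V}. pmf p x) \<ge> 98 / 100"
    using small_doubling_subgroup[OF p(1,2)] by blast
  obtain f :: "(nat \<Rightarrow> bit) \<Rightarrow> (nat \<Rightarrow> bit)" where f: "add_hom f" "\<And>x. f x = 0 \<longleftrightarrow> x \<in> V"
    using exists_hom_with_kernel[OF V(1,2)] by blast
  have fp: "finite (set_pmf (map_pmf f p))" "finite (set_pmf (map_pmf f r))" using p r by auto
  have "log_doubling (map_pmf f p) \<le> 1 / 1000"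
    using conv_data_processing[OF f(1) p(1) p(1)] p(2) by (simp add: log_doubling_def)
  then have "ent (map_pmf f p) \<le> 1"
    using V(4) unfolding pmf_map_hom[OF f p(1), symmetric] by (intro ent_le_of_atom[OF fp(1)]) auto
  moreover have "ent (map_pmf f r) \<le> ent (conv (map_pmf f r) (map_pmf f p))"
    by (rule ent_le_conv[OF fp(2,1)])
  moreover have "ent (conv (map_pmf f r) (map_pmf f p)) - ent (map_pmf f p) \<le> ent (conv r p) - ent p"
    by (rule conv_data_processing[OF f(1) r p(1)])
  moreover have "3 * (\<delta> * M) \<le> gain r p"
  proof -
    have "0 \<le> \<epsilon>\<^sup>2 / 8 * ent p" by simp
    with low show ?thesis by linarith
  qed
  ultimately have "ent (map_pmf f r) \<le> ent r - \<delta> * M"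
    using M(2) unfolding gain_def by linarith
  moreover have "ln (real (card V)) \<le> (256 * 2 ^ (2 * N + 1) / \<epsilon>\<^sup>2 + 2) * M"
    using V(3) entp M1 by (simp add: distrib_right)
  ultimately show ?thesis using p0(1) f V(1) unfolding r_def by blast
qed

text \<open>The homomorphisms act on the whole type and their kernels need not lie in
  \<open>F2_space n\<close>; only the part inside the finite group \<open>F\<close> is kept.\<close>

definition kernel_in :: "'g::boolean_group set \<Rightarrow> ('g \<Rightarrow> 'h::boolean_group) \<Rightarrow> 'g set"
  where "kernel_in F f = {x\<in>F. f x = 0}"

text \<open>The composite kernel is a union of fibres of \<open>f\<close> over \<open>V\<close>, and
  a nonempty fibre is translated into the kernel of \<open>f\<close> by any of its points.\<close>

lemma card_kernel_comp:
  assumes F: "finite F" "is_subgroup F" and f: "add_hom f" and V: "finite V" "\<And>x. g x = 0 \<longleftrightarrow> x \<in> V"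
  shows "card (kernel_in F (\<lambda>x. g (f x))) \<le> card V * card (kernel_in F f)"
proof -
  have "kernel_in F (\<lambda>x. g (f x)) = (\<Union>v\<in>V. {x\<in>F. f x = v})"
    by (auto simp: kernel_in_def V)
  also have "card \<dots> \<le> (\<Sum>v\<in>V. card {x\<in>F. f x = v})" by (rule card_UN_le[OF V(1)])
  also have "\<dots> \<le> (\<Sum>v\<in>V. card (kernel_in F f))"
  proof (rule sum_mono)
    fix v
    show "card {x\<in>F. f x = v} \<le> card (kernel_in F f)"
    proof (cases "{x\<in>F. f x = v} = {}")
      case True
      show ?thesis unfolding True by simp
    next
      case False
      then obtain a where a: "a \<in> F" "f a = v" by auto
      show ?thesis
      proof (rule card_inj_on_le[of "\<lambda>x. x + a"])
        show "(\<lambda>x. x + a) ` {x\<in>F. f x = v} \<subseteq> kernel_in F f"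
          using a F f by (auto simp: kernel_in_def is_subgroup_def add_hom_def)
      qed (use F in \<open>auto simp: kernel_in_def inj_on_def\<close>)
    qed
  qed
  finally show ?thesis by simp
qed

text \<open>The sum of the entropies of the convolution powers is a potential. Until the last
  inequality holds, a further quotient lowers one summand by \<delta> M and raises none, so
  \<open>k\<close> quotients suffice, each enlarging the kernel by a factor of at most exp (L
  M).\<close>

lemma entropy_iteration:
  fixes X :: "(nat \<Rightarrow> bit) pmf"
  assumes X: "finite (set_pmf X)" and \<epsilon>: "0 < \<epsilon>" "\<epsilon> \<le> 1" and M: "ent X \<le> M" "1 \<le> \<delta> * M"
    and N: "1000 / \<epsilon>\<^sup>2 \<le> real N" and \<delta>: "\<delta> = \<epsilon> ^ (N + 3) / 8"
    and L: "L = 256 * 2 ^ (2 * N + 1) / \<epsilon>\<^sup>2 + 2" and F: "finite F" "is_subgroup F"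
    and f: "add_hom (f :: (nat \<Rightarrow> bit) \<Rightarrow> (nat \<Rightarrow> bit))"
    and pot: "(\<Sum>j\<le>2 * N + 1. ent (map_pmf f (conv_pow X j))) \<le> real k * (\<delta> * M)"
  shows "\<exists>f' :: (nat \<Rightarrow> bit) \<Rightarrow> (nat \<Rightarrow> bit). add_hom f' \<and>
    ln (real (card (kernel_in F f'))) \<le> ln (real (card (kernel_in F f))) + real k * (L * M) \<and>
    2 * ent (map_pmf f' X) - \<epsilon> * M < ent (conv (map_pmf f' X) (map_pmf f' X))"
  using f pot
proof (induction k arbitrary: f)
  case 0
  have "0 < \<delta>" using \<epsilon> by (simp add: \<delta>)
  then have M0: "0 < M" using M(2) by (smt (verit) mult_nonneg_nonpos)
  \<comment> \<open>At potential 0 the image of \<open>X\<close> has entropy 0, and the strict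
    inequality is immediate.\<close>
  have "ent (map_pmf f (conv_pow X 0)) \<le> (\<Sum>j\<le>2 * N + 1. ent (map_pmf f (conv_pow X j)))"
    by (rule member_le_sum) auto
  then have "ent (map_pmf f X) \<le> 0" using 0(2) by simp
  then have "2 * ent (map_pmf f X) - \<epsilon> * M < 0" using mult_pos_pos[OF \<epsilon>(1) M0] by linarith
  also have "0 \<le> ent (conv (map_pmf f X) (map_pmf f X))" by simp
  finally show ?case using 0(1) by (intro exI[of _ f]) simp
next
  case (Suc k)
  have kpos: "0 < card (kernel_in F f)" if "add_hom f" for f :: "(nat \<Rightarrow> bit) \<Rightarrow> (nat \<Rightarrow> bit)"
    using F add_hom_0[OF that] by (auto simp: card_gt_0_iff kernel_in_def is_subgroup_def)
  have "0 < \<delta>" using \<epsilon> by (simp add: \<delta>)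
  then have M0: "0 < M" using M(2) by (smt (verit) mult_nonneg_nonpos)
  have L0: "0 \<le> L * M" using M0 by (simp add: L)
  show ?case
  proof (cases "2 * ent (map_pmf f X) - \<epsilon> * M < ent (conv (map_pmf f X) (map_pmf f X))")
    case True
    then show ?thesis using Suc.prems L0 by (intro exI[of _ f]) auto
  next
    case False
    have "finite (set_pmf (map_pmf f X))" "ent (map_pmf f X) \<le> M"
      using X M ent_map_le[OF X, of f] by auto
    from entropy_decrement[OF this(1) \<epsilon> this(2) M(2) _ N \<delta>, folded L] False
    obtain i g V where g: "i \<le> 2 * N + 1" "add_hom (g :: (nat \<Rightarrow> bit) \<Rightarrow> (nat \<Rightarrow> bit))" "finite V"
      "\<And>x. g x = 0 \<longleftrightarrow> x \<in> V" "ln (real (card V)) \<le> L * M"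
      "ent (map_pmf g (conv_pow (map_pmf f X) i)) \<le> ent (conv_pow (map_pmf f X) i) - \<delta> * M"
      by (force simp: not_less)
    define h where "h = (\<lambda>x. g (f x))"
    have h: "add_hom h" using g(2) Suc.prems(1) by (simp add: h_def add_hom_def)
    have gj: "ent (map_pmf h (conv_pow X j)) = ent (map_pmf g (map_pmf f (conv_pow X j)))" for j
      by (simp add: h_def map_pmf_comp)
    have "(\<Sum>j\<le>2 * N + 1. ent (map_pmf h (conv_pow X j)))
      \<le> (\<Sum>j\<le>2 * N + 1. ent (map_pmf f (conv_pow X j)) - (if j = i then \<delta> * M else 0))"
    proof (rule sum_mono)
      fix j
      show "ent (map_pmf h (conv_pow X j)) \<le> ent (map_pmf f (conv_pow X j)) - (if j = i then \<delta> * M else 0)"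
        unfolding gj using g(6) ent_map_le[of "map_pmf f (conv_pow X j)" g] X
        by (auto simp: map_conv_pow[OF Suc.prems(1)])
    qed
    also have "\<dots> = (\<Sum>j\<le>2 * N + 1. ent (map_pmf f (conv_pow X j))) - \<delta> * M"
      using g(1) by (simp add: sum_subtractf)
    also have "\<dots> \<le> real k * (\<delta> * M)" using Suc.prems(2) by (simp add: algebra_simps)
    finally obtain f' :: "(nat \<Rightarrow> bit) \<Rightarrow> (nat \<Rightarrow> bit)" where f': "add_hom f'"
      "ln (real (card (kernel_in F f'))) \<le> ln (real (card (kernel_in F h))) + real k * (L * M)"
      "2 * ent (map_pmf f' X) - \<epsilon> * M < ent (conv (map_pmf f' X) (map_pmf f' X))"
      using Suc.IH[OF h] by blast
    have "real (card (kernel_in F h)) \<le> real (card V) * real (card (kernel_in F f))"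
      using card_kernel_comp[OF F Suc.prems(1) g(3,4)] unfolding h_def of_nat_mult[symmetric] of_nat_le_iff .
    moreover have "0 < card V" using g(3,4) add_hom_0[OF g(2)] by (auto simp: card_gt_0_iff)
    ultimately have "ln (real (card (kernel_in F h))) \<le> ln (real (card V) * real (card (kernel_in F f)))"
      using kpos[OF h] kpos[OF Suc.prems(1)] by (subst ln_le_cancel_iff) auto
    also have "\<dots> = ln (real (card V)) + ln (real (card (kernel_in F f)))"
      using \<open>0 < card V\<close> kpos[OF Suc.prems(1)] by (simp add: ln_mult)
    finally have "ln (real (card (kernel_in F h))) \<le> ln (real (card V)) + ln (real (card (kernel_in F f)))" .
    then have "ln (real (card (kernel_in F f'))) \<le> ln (real (card (kernel_in F f))) + real (Suc k) * (L * M)"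
      using f'(2) g(5) by (simp add: algebra_simps)
    then show ?thesis using f' by blast
  qed
qed

section \<open>Application to a set of vectors\<close>

lemma finite_F2_space: "finite (F2_space n)"
proof -
  have "F2_space n \<subseteq> (\<lambda>S i. if i \<in> S then 1 else 0) ` Pow {..<n}"
  proof
    fix x assume x: "x \<in> F2_space n"
    have "x = (\<lambda>i. if i \<in> {i. i < n \<and> x i = 1} then 1 else 0)"
    proof
      fix i
      show "x i = (if i \<in> {i. i < n \<and> x i = 1} then 1 else 0)"
        using x by (cases "x i") (auto simp: F2_space_def not_less[symmetric])
    qed
    then show "x \<in> (\<lambda>S i. if i \<in> S then 1 else 0) ` Pow {..<n}" by (rule image_eqI) auto
  qed
  then show ?thesis by (rule finite_subset) simp
qed

lemma is_subgroup_F2_space: "is_subgroup (F2_space n)"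
  by (auto simp: is_subgroup_def F2_space_def)

lemma subspace_if_is_subgroup:
  assumes "is_subgroup V"
  shows "F2.subspace V"
proof -
  have "F2_scale c x = (if c = 1 then x else 0)" for c x
    by (cases c) (auto simp: F2_scale_def fun_eq_iff)
  then show ?thesis using assms by (auto simp: F2.subspace_def is_subgroup_def)
qed

lemma mem_elt_set_plus_iff: "b \<in> (a :: 'g::boolean_group) +o V \<longleftrightarrow> a + b \<in> V"
  unfolding elt_set_plus_def by (auto simp: intro: bexI[of _ "a + b"])

text \<open>The coset through a point of \<open>A\<close> meets \<open>A\<close> in the fibre of
  \<open>f\<close> through that point, so the size of the intersection divided by that of
  \<open>A\<close> is an atom of the image law.\<close>

lemma avg_ln_coset:
  assumes A: "finite A" "A \<noteq> {}" and V: "\<And>a b. a \<in> A \<Longrightarrow> b \<in> A \<Longrightarrow> a + b \<in> V \<longleftrightarrow> f b = f (a :: 'g::boolean_group)"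
  shows "avg A (\<lambda>a. ln (real (card (A \<inter> (a +o V))))) = ln (real (card A)) - ent (map_pmf f (pmf_of_set A))"
proof -
  have cA: "0 < card A" using A by (simp add: card_gt_0_iff)
  have pmf: "pmf (map_pmf f (pmf_of_set A)) (f a) = real (card (A \<inter> (a +o V))) / real (card A)" if a: "a \<in> A" for a
  proof -
    have "A \<inter> f -` {f a} = A \<inter> (a +o V)" using V[OF a] by (auto simp: mem_elt_set_plus_iff)
    then show ?thesis using A by (simp add: pmf_map measure_pmf_of_set)
  qed
  have pos: "0 < card (A \<inter> (a +o V))" if a: "a \<in> A" for a
    using A V[OF a a] a by (auto simp: card_gt_0_iff mem_elt_set_plus_iff)
  have *: "- ln (pmf (map_pmf f (pmf_of_set A)) (f a)) = ln (real (card A)) - ln (real (card (A \<inter> (a +o V))))"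
    if "a \<in> A" for a
    unfolding pmf[OF that] using cA pos[OF that] by (subst ln_div) auto
  have "ent (map_pmf f (pmf_of_set A))
     = (\<Sum>a\<in>A. 1 / real (card A) * (ln (real (card A)) - ln (real (card (A \<inter> (a +o V))))))"
    using A H_expect[of "pmf_of_set A" f] unfolding ent_map by (simp add: * del: minus_diff_eq)
  also have "\<dots> = ln (real (card A)) - avg A (\<lambda>a. ln (real (card (A \<inter> (a +o V)))))"
    using cA unfolding avg_def by (simp add: sum_subtractf flip: sum_divide_distrib) (simp add: field_simps)
  finally show ?thesis by simp
qed

lemma ent_pmf_of_set: "finite A \<Longrightarrow> A \<noteq> {} \<Longrightarrow> ent (pmf_of_set A) = ln (real (card A))"
  by (simp add: ent_def ln_div)

lemma large_set_case:
  fixes A :: "(nat \<Rightarrow> bit) set"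
  assumes \<epsilon>: "0 < \<epsilon>" "\<epsilon> \<le> 1" and N: "1000 / \<epsilon>\<^sup>2 \<le> real N" and \<delta>: "\<delta> = \<epsilon> ^ (N + 3) / 8"
    and L: "L = 256 * 2 ^ (2 * N + 1) / \<epsilon>\<^sup>2 + 2" and k: "(2 * real N + 2) * 2 ^ (2 * N + 1) \<le> real k * \<delta>"
    and A: "A \<subseteq> F2_space n" "finite A" "A \<noteq> {}" and M: "1 \<le> \<delta> * ln (real (card A))"
    and \<eta>: "real (card (A + A)) = real (card A) powr (2 - \<eta>)"
  shows "\<exists>V. F2.subspace V \<and> V \<subseteq> F2_space n \<and> real (card V) \<le> real (card A) powr (real k * L) \<and>
    avg A (\<lambda>a. ln (real (card (A \<inter> (a +o V))))) \<ge> (\<eta> - \<epsilon>) * ln (real (card A))"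
proof -
  define M where "M = ln (real (card A))"
  define X where "X = pmf_of_set A"
  have cA: "0 < card A" using A by (simp add: card_gt_0_iff)
  have "0 < \<delta>" using \<epsilon> by (simp add: \<delta>)
  then have M0: "0 < M" using M unfolding M_def by (smt (verit) mult_nonneg_nonpos)
  have X: "finite (set_pmf X)" "ent X = M" using A by (simp_all add: X_def M_def ent_pmf_of_set)
  let ?F = "F2_space n"
  \<comment> \<open>\<open>k\<close> is chosen to absorb this initial potential: 2 N + 2 powers,
    each of entropy at most 2^(2 N + 1) M.\<close>
  have "(\<Sum>j\<le>2 * N + 1. ent (map_pmf (\<lambda>x. x) (conv_pow X j))) \<le> (\<Sum>j\<le>2 * N + 1. 2 ^ (2 * N + 1) * M)"
  proof (rule sum_mono)
    fix j assume "j \<in> {..2 * N + 1}"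
    then have "2 ^ j * M \<le> 2 ^ (2 * N + 1) * M" using M0 by (intro mult_right_mono power_increasing) auto
    then show "ent (map_pmf (\<lambda>x. x) (conv_pow X j)) \<le> 2 ^ (2 * N + 1) * M"
      using ent_conv_pow_le[OF X(1), of j] X(2) by simp
  qed
  also have "\<dots> = (2 * real N + 2) * 2 ^ (2 * N + 1) * M" by simp
  also have "\<dots> \<le> real k * \<delta> * M" using k M0 by (intro mult_right_mono) auto
  finally have pot: "(\<Sum>j\<le>2 * N + 1. ent (map_pmf (\<lambda>x. x) (conv_pow X j))) \<le> real k * (\<delta> * M)" by simp
  have id: "add_hom (\<lambda>x :: nat \<Rightarrow> bit. x)" by (simp add: add_hom_def)
  obtain f :: "(nat \<Rightarrow> bit) \<Rightarrow> (nat \<Rightarrow> bit)" where f: "add_hom f"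
    "ln (real (card (kernel_in ?F f))) \<le> ln (real (card (kernel_in ?F (\<lambda>x. x)))) + real k * (L * M)"
    "2 * ent (map_pmf f X) - \<epsilon> * M < ent (conv (map_pmf f X) (map_pmf f X))"
    using entropy_iteration[OF X(1) \<epsilon> _ _ N \<delta> L finite_F2_space is_subgroup_F2_space id pot] M X(2)
    unfolding M_def by auto
  define V where "V = kernel_in ?F f"
  have sub: "is_subgroup V"
    using is_subgroup_F2_space[of n] f(1) add_hom_0[OF f(1)] by (auto simp: V_def kernel_in_def is_subgroup_def add_hom_def)
  have cV: "0 < card V" using sub finite_F2_space[of n] by (auto simp: card_gt_0_iff V_def kernel_in_def is_subgroup_def)
  have "kernel_in ?F (\<lambda>x. x) = {0}" using is_subgroup_F2_space[of n] by (auto simp: kernel_in_def is_subgroup_def)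
  then have "ln (real (card V)) \<le> real k * L * M" using f(2) by (simp add: V_def)
  then have "exp (ln (real (card V))) \<le> exp (real k * L * M)" by simp
  then have "real (card V) \<le> real (card A) powr (real k * L)"
    using cA cV by (simp add: M_def powr_def)
  moreover have "avg A (\<lambda>a. ln (real (card (A \<inter> (a +o V))))) \<ge> (\<eta> - \<epsilon>) * M"
  proof -
    have "a + b \<in> V \<longleftrightarrow> f b = f a" if "a \<in> A" "b \<in> A" for a b
    proof -
      have "a + b \<in> ?F" using that A is_subgroup_F2_space[of n] by (auto simp: is_subgroup_def)
      moreover have "f a + f b = 0 \<longleftrightarrow> f b = f a" by (metis add.right_neutral add_self add_self_left)
      ultimately show ?thesis using f(1) by (simp add: V_def kernel_in_def add_hom_def)
    qed
    from avg_ln_coset[OF A(2,3) this]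
    have avg: "avg A (\<lambda>a. ln (real (card (A \<inter> (a +o V))))) = M - ent (map_pmf f X)" by (simp add: M_def X_def)
    have "set_pmf (conv X X) = A + A" using A by (simp add: conv_def X_def set_plus_image case_prod_unfold)
    then have "ent (conv X X) \<le> ln (real (card (A + A)))"
      using A by (intro ent_le_ln_card) (auto intro: finite_set_plus)
    also have "\<dots> = (2 - \<eta>) * M" using cA by (simp add: \<eta> M_def ln_powr)
    finally have "ent (conv X X) \<le> (2 - \<eta>) * M" .
    \<comment> \<open>Data processing bounds H(f X + f X') - H(f X) by (1 - \<eta>) M, while
      \<open>f\<close> makes it exceed H(f X) - \<epsilon> M. Hence H(f X) < (1 - \<eta> +
      \<epsilon>) M.\<close>
    then show ?thesis
      using conv_data_processing[OF f(1) X(1) X(1)] f(3) X(2) unfolding avg by (simp add: algebra_simps)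
  qed
  ultimately show ?thesis
    using subspace_if_is_subgroup[OF sub] unfolding M_def by (intro exI[of _ V]) (auto simp: V_def kernel_in_def)
qed

text \<open>For bounded sets the span of \<open>A\<close> is small enough: its size is at most 2^|A|
  \<le> |A|^|A|. It contains all differences, so the average is ln |A|, and \<eta> \<le> 1 because
  |A + A| \<ge> |A|.\<close>

lemma small_set_case:
  fixes A :: "(nat \<Rightarrow> bit) set"
  assumes A: "A \<subseteq> F2_space n" "finite A" "A \<noteq> {}" and L: "real (card A) \<le> L"
    and \<eta>: "real (card (A + A)) = real (card A) powr (2 - \<eta>)" and \<epsilon>: "0 < \<epsilon>"
  shows "\<exists>V. F2.subspace V \<and> V \<subseteq> F2_space n \<and> real (card V) \<le> real (card A) powr L \<and>
    avg A (\<lambda>a. ln (real (card (A \<inter> (a +o V))))) \<ge> (\<eta> - \<epsilon>) * ln (real (card A))"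
proof (cases "card A = 1")
  case True
  \<comment> \<open>For a singleton every power of |A| is 1, so \<eta> is unconstrained; but ln |A|
    = 0 and the zero subspace works.\<close>
  then obtain a where a: "A = {a}" by (auto simp: card_1_singleton_iff)
  have "A \<inter> (a +o {0}) = {a}" by (auto simp: a elt_set_plus_def)
  then show ?thesis
    using is_subgroup_F2_space[of n] unfolding a
    by (intro exI[of _ "{0}"]) (auto simp: avg_def is_subgroup_def intro!: subspace_if_is_subgroup)
next
  case False
  have cA: "2 \<le> card A" using A False by (metis One_nat_def Suc_1 card_gt_0_iff le_neq_implies_less less_eq_Suc_le not_less_eq_eq)
  obtain F where F: "finite F" "card F \<le> 2 ^ card A" "is_subgroup F" "A \<subseteq> F"
    using finite_subset_subgroup[OF A(2)] by blast
  define V where "V = F \<inter> F2_space n"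
  have sub: "is_subgroup V" using F(3) is_subgroup_F2_space[of n] by (auto simp: V_def is_subgroup_def)
  have AV: "A \<subseteq> V" using F A by (auto simp: V_def)
  have "A \<inter> (a +o V) = A" if "a \<in> A" for a
    using AV that sub by (auto simp: mem_elt_set_plus_iff is_subgroup_def subset_iff)
  then have avg: "avg A (\<lambda>a. ln (real (card (A \<inter> (a +o V))))) = ln (real (card A))"
    using A cA by (simp add: avg_def)
  have "real (card A) powr 1 \<le> real (card A) powr (2 - \<eta>)"
  proof -
    obtain a where a: "a \<in> A" using A by blast
    have "card A \<le> card (A + A)"
      by (rule card_inj_on_le[of "(+) a"]) (use A a in \<open>auto simp: inj_on_def set_plus_def intro: finite_set_plus[unfolded set_plus_def]\<close>)
    then show ?thesis using cA \<eta> by simp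
  qed
  then have "\<eta> \<le> 1" using cA by (subst (asm) powr_le_cancel_iff) auto
  then have "(\<eta> - \<epsilon>) * ln (real (card A)) \<le> 1 * ln (real (card A))"
    using \<epsilon> cA by (intro mult_right_mono) auto
  moreover have "real (card V) \<le> real (card A) powr L"
  proof -
    have "card V \<le> 2 ^ card A" using F card_mono[of F V] by (auto simp: V_def)
    then have "real (card V) \<le> 2 ^ card A" by (metis of_nat_le_iff of_nat_numeral of_nat_power)
    also have "\<dots> \<le> real (card A) ^ card A" using cA by (intro power_mono) auto
    also have "\<dots> = real (card A) powr real (card A)" using cA by (simp add: powr_realpow)
    also have "\<dots> \<le> real (card A) powr L" using cA L by (intro powr_mono) auto
    finally show ?thesis .
  qed
  ultimately show ?thesis
    using subspace_if_is_subgroup[OF sub] avg by (intro exI[of _ V]) (auto simp: V_def)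
qed

theorem theorem1p1:
  shows "\<forall>\<epsilon>::real. \<epsilon> > 0 \<longrightarrow> (\<exists>L::real. L > 0 \<and>
    (\<forall>(n::nat) (A :: (nat \<Rightarrow> bit) set) (\<eta>::real).
      n \<ge> 1 \<longrightarrow> A \<subseteq> F2_space n \<longrightarrow> finite A \<longrightarrow> A \<noteq> {} \<longrightarrow>
      real (card (A + A)) = real (card A) powr (2 - \<eta>) \<longrightarrow>
      (\<exists>V. F2.subspace V \<and> V \<subseteq> F2_space n \<and>
        real (card V) \<le> real (card A) powr L \<and>
        avg A (\<lambda>a. ln (real (card (A \<inter> (a +o V))))) \<ge> (\<eta> - \<epsilon>) * ln (real (card A)))))"
proof (intro allI impI)
  fix \<epsilon> :: real assume \<epsilon>: "0 < \<epsilon>"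
  \<comment> \<open>The entropic part assumes a parameter of at most 1, and shrinking \<epsilon>
    only strengthens the conclusion.\<close>
  define e where "e = min \<epsilon> 1"
  have e: "0 < e" "e \<le> 1" "e \<le> \<epsilon>" using \<epsilon> by (auto simp: e_def)
  define N where "N = nat \<lceil>1000 / e\<^sup>2\<rceil>"
  have N: "1000 / e\<^sup>2 \<le> real N" by (simp add: N_def real_nat_ceiling_ge)
  define \<delta> where "\<delta> = e ^ (N + 3) / 8"
  have \<delta>: "0 < \<delta>" using e by (simp add: \<delta>_def)
  define L where "L = 256 * 2 ^ (2 * N + 1) / e\<^sup>2 + 2"
  define k where "k = nat \<lceil>(2 * real N + 2) * 2 ^ (2 * N + 1) / \<delta>\<rceil>"
  have "(2 * real N + 2) * 2 ^ (2 * N + 1) / \<delta> \<le> real k" unfolding k_def by (rule real_nat_ceiling_ge)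
  then have k: "(2 * real N + 2) * 2 ^ (2 * N + 1) \<le> real k * \<delta>" using \<delta> by (simp add: pos_divide_le_eq)
  \<comment> \<open>The first term serves sets with \<delta> ln |A| \<ge> 1, and the second bounds
    |A| for all others.\<close>
  define L' where "L' = max (real k * L) (exp (1 / \<delta>))"
  show "\<exists>L::real. L > 0 \<and>
    (\<forall>(n::nat) (A :: (nat \<Rightarrow> bit) set) (\<eta>::real).
      n \<ge> 1 \<longrightarrow> A \<subseteq> F2_space n \<longrightarrow> finite A \<longrightarrow> A \<noteq> {} \<longrightarrow>
      real (card (A + A)) = real (card A) powr (2 - \<eta>) \<longrightarrow>
      (\<exists>V. F2.subspace V \<and> V \<subseteq> F2_space n \<and>
        real (card V) \<le> real (card A) powr L \<and>
        avg A (\<lambda>a. ln (real (card (A \<inter> (a +o V))))) \<ge> (\<eta> - \<epsilon>) * ln (real (card A))))"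
  proof (intro exI[of _ L'] conjI allI impI)
    show "0 < L'" by (simp add: L'_def less_max_iff_disj)
    fix n :: nat and A :: "(nat \<Rightarrow> bit) set" and \<eta> :: real
    assume A: "A \<subseteq> F2_space n" "finite A" "A \<noteq> {}"
      and \<eta>: "real (card (A + A)) = real (card A) powr (2 - \<eta>)"
    have cA: "1 \<le> real (card A)" using A by (simp add: Suc_leI card_gt_0_iff)
    show "\<exists>V. F2.subspace V \<and> V \<subseteq> F2_space n \<and> real (card V) \<le> real (card A) powr L' \<and>
        avg A (\<lambda>a. ln (real (card (A \<inter> (a +o V))))) \<ge> (\<eta> - \<epsilon>) * ln (real (card A))"
    proof (cases "1 \<le> \<delta> * ln (real (card A))")
      case True
      have "(\<eta> - \<epsilon>) * ln (real (card A)) \<le> (\<eta> - e) * ln (real (card A))"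
        using e cA by (intro mult_right_mono) auto
      moreover have "real (card A) powr (real k * L) \<le> real (card A) powr L'"
        using cA by (intro powr_mono) (auto simp: L'_def)
      ultimately show ?thesis
        using large_set_case[OF e(1,2) N \<delta>_def L_def k A True \<eta>] by (meson order_trans)
    next
      case False
      then have "ln (real (card A)) \<le> 1 / \<delta>" using \<delta> by (simp add: pos_le_divide_eq mult.commute)
      then have "real (card A) \<le> exp (1 / \<delta>)" using cA by (metis exp_le_cancel_iff exp_ln less_le_trans zero_less_one)
      then have "real (card A) \<le> L'" by (simp add: L'_def)
      from small_set_case[OF A this \<eta> \<epsilon>] show ?thesis .
    qed
  qed
qed

end
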